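(* Let $K$ be a real constant with $1\le K\le 1.3$, and consider the nonlocal ODE family for $G=G(x,t)$, $x\in[0,1]$, $t\ge 0$, $$\partial_t G(x,t)=\int_0^1\frac{(y-K^{-1}x)\,e^{-G(y,t)}}{\left(y^2+e^{-2G(y,t)}\right)^2}\,dy,\qquad G(x,0)=0 .$$ Then the solution is global in time, i.e. it exists for all $t\in[0,\infty)$. Moreover, writing $G(x,t)=A(t)-B(t)x$, the following asymptotic behavior holds for $t\ge 1$: $$e^{A(t)}\approx B(t)^{K/3},\qquad B(t)\approx t^{1/(2-K)} .$$
   Context: Since the right-hand side of the equation is affine in $x$ and $G(\cdot,0)=0$, the solution has the form $G(x,t)=A(t)-B(t)x$ with $A(0)=B(0)=0$; this defines $A$ and $B$. Notation: for positive quantities $X(t),Y(t)$, "$X\approx Y$ for $t\ge 1$" means that there is a constant $C\ge 1$, independent of $t$ (it may depend on the fixed model parameter $K$), such that $\frac1C Y(t)\le X(t)\le C\,Y(t)$ for all $t\ge 1$. *)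

theory Defs
  imports "HOL-Analysis.Analysis"
begin

definition ode_integrand :: "real \<Rightarrow> (real \<Rightarrow> real) \<Rightarrow> real \<Rightarrow> real \<Rightarrow> real" where
  "ode_integrand K g x y =
     (y - inverse K * x) * exp (- g y) / (y\<^sup>2 + exp (- 2 * g y))\<^sup>2"

text \<open>
  Solutions on a time interval \<open>J\<close> starting at \<open>0\<close>, either \<open>{0..<T}\<close> or \<open>{0..}\<close>;
  the time derivative is one-sided at \<open>t = 0\<close>.  Integrability is required explicitly
  because \<^const>\<open>integral\<close> is \<open>0\<close> by convention on non-integrable functions.  No form of
  \<open>G x t\<close> in \<open>x\<close> is presupposed, and values outside \<open>{0..1} \<times> J\<close> are irrelevant.
\<close>

definition ode_solution :: "real \<Rightarrow> real set \<Rightarrow> (real \<Rightarrow> real \<Rightarrow> real) \<Rightarrow> bool" where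
  "ode_solution K J G \<longleftrightarrow>
     (\<forall>x\<in>{0..1}. G x 0 = 0) \<and>
     (\<forall>x\<in>{0..1}. \<forall>t\<in>J.
        ode_integrand K (\<lambda>y. G y t) x integrable_on {0..1} \<and>
        ((\<lambda>s. G x s) has_real_derivative
           integral {0..1} (ode_integrand K (\<lambda>y. G y t) x)) (at t within J))"

definition comparable_from_1 :: "(real \<Rightarrow> real) \<Rightarrow> (real \<Rightarrow> real) \<Rightarrow> bool" where
  "comparable_from_1 X Y \<longleftrightarrow>
     (\<forall>t\<ge>1. 0 < X t \<and> 0 < Y t) \<and>
     (\<exists>C\<ge>1. \<forall>t\<ge>1. 1 / C * Y t \<le> X t \<and> X t \<le> C * Y t)"

end

theory Submission
  imports Defs
begin

text \<open>
  Put \<open>p = y\<^sup>2 e\<^sup>2\<^sup>G\<close>.  The integrand is \<open>(y - x / K) k\<close> with \<open>k = e\<^sup>3\<^sup>G / (1 + p)\<^sup>2\<close>, so it is affine in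
  \<open>x\<close>, every solution has the form \<open>G = A - B x\<close>, and the equation becomes the planar system
  \<open>A' = m\<^sub>1\<close>, \<open>K B' = m\<^sub>0\<close> for the moments \<open>m\<^sub>n = \<integral> y\<^sup>n k dy\<close> over \<open>[0,1]\<close>.

  Everything rests on one exact relation between the two moments (lemma \<open>virial_identity\<close>).
  Along \<open>G = A - B y\<close>,
  \<open>d/dy (y e\<^sup>3\<^sup>G / (1 + p)) = k (1 - 3 B y - p (1 + B y))\<close>, and integration gives
  \<open>m\<^sub>0 - 3 B m\<^sub>1 = (boundary term) + \<integral> k p (1 + B y) dy\<close>.  Both terms on the right are nonnegative,
  so \<open>3 B A' \<le> K B'\<close>: the function \<open>A - (K/3) ln B\<close> never increases.  This is already the sharp upper
  bound \<open>e\<^sup>A \<le> C B\<^bsup>K/3\<^esup>\<close> for \<open>t \<ge> 1\<close>.  It makes \<open>y e\<^sup>G \<le> e\<^sup>A / B\<close> bounded, so \<open>k\<close> is comparable to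
  \<open>e\<^sup>3\<^sup>G\<close> and \<open>B'\<close> is comparable to \<open>e\<^sup>3\<^sup>A / B\<close>.  The right-hand side of the identity is then at most a
  multiple of \<open>m\<^sub>0 / B\<close>, hence \<open>A - (K/3) ln B\<close> loses at most the integral of a multiple of
  \<open>B' / B\<^sup>2\<close>, which is finite; this is the lower bound \<open>e\<^sup>A \<ge> c B\<^bsup>K/3\<^esup>\<close>.  Finally \<open>B'\<close> is comparable to
  \<open>B\<^bsup>K-1\<^esup>\<close>, so the derivative of \<open>B\<^bsup>2-K\<^esup>\<close> lies between positive constants, and \<open>B\<^bsup>2-K\<^esup>\<close> grows linearly.

  For existence, \<open>3 B m\<^sub>1 \<le> m\<^sub>0\<close> together with \<open>m\<^sub>1 \<le> m\<^sub>0\<close> also controls the regime of small \<open>B\<close> and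
  yields the a priori bound \<open>A(t) \<le> 18 t\<close> (lemma \<open>a_priori_bound\<close>).  Since \<open>B \<ge> 0\<close>, the exponent
  \<open>G \<le> A\<close> then never reaches \<open>1 + 18 t\<close>.  Cutting it off at that level makes the vector field Lipschitz
  with a constant that depends on time only, for which Picard iteration in a weighted sup norm gives a
  solution for all times at once; the cut-off is never active.  Uniqueness is Gronwall's argument.
\<close>

section \<open>Ordinary differential equations with a time-dependent Lipschitz constant\<close>

text \<open>
  If \<open>\<Lambda>\<close> is a primitive of the Lipschitz constant \<open>L\<close>, the Picard operator contracts by \<open>1/2\<close> in the norm
  \<open>sup e\<^bsup>-2\<Lambda>(t)\<^esup> |x(t)|\<close>, because \<open>e\<^bsup>-2\<Lambda>(t)\<^esup> \<integral> L e\<^bsup>2\<Lambda>\<^esup> \<le> 1/2\<close>.  One fixed point therefore lives on the whole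
  half line, and no local solutions have to be continued.  The bound on \<open>f t 0\<close> keeps the operator inside
  the space of functions of finite norm.  The fixed point below is the weighted function \<open>e\<^bsup>-2\<Lambda>\<^esup> x\<close>, so
  that the unweighted space of bounded continuous functions can be used.
\<close>
lemma picard_global:
  fixes f :: "real \<Rightarrow> 'a::banach \<Rightarrow> 'a" and L \<Lambda> :: "real \<Rightarrow> real"
  assumes cont: "continuous_on ({0..} \<times> UNIV) (\<lambda>(t, x). f t x)"
    and lip: "\<And>t x y. 0 \<le> t \<Longrightarrow> norm (f t x - f t y) \<le> L t * norm (x - y)"
    and bound: "\<And>t. 0 \<le> t \<Longrightarrow> norm (f t 0) \<le> L t"
    and deriv: "\<And>t. 0 \<le> t \<Longrightarrow> (\<Lambda> has_real_derivative L t) (at t)"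
    and zero: "\<Lambda> 0 = 0"
  obtains x where "x 0 = x0"
    and "\<And>t. 0 \<le> t \<Longrightarrow> (x has_vector_derivative f t (x t)) (at t within {0..})"
proof -
  have L_nonneg: "0 \<le> L t" if "0 \<le> t" for t
    using bound[OF that] norm_ge_zero order_trans by blast
  have \<Lambda>_nonneg: "0 \<le> \<Lambda> t" if "0 \<le> t" for t
    using DERIV_nonneg_imp_nondecreasing[OF that, of \<Lambda>] deriv L_nonneg zero by metis
  have cont_\<Lambda>: "continuous_on {0..} \<Lambda>"
    by (meson DERIV_isCont atLeast_iff continuous_at_imp_continuous_on deriv)
  define W where "W t = exp (2 * \<Lambda> t)" for t
  have W_pos: "0 < W t" for t by (simp add: W_def)
  have cont_W: "continuous_on {0..} W"
    unfolding W_def by (intro continuous_intros cont_\<Lambda>)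
  have W_int: "((\<lambda>s. L s * W s) has_integral (W t - 1) / 2) {0..t}" if "0 \<le> t" for t
  proof -
    have "((\<lambda>s. L s * W s) has_integral (W t / 2 - W 0 / 2)) {0..t}"
    proof (rule fundamental_theorem_of_calculus[OF that])
      fix s assume "s \<in> {0..t}"
      then have "((\<lambda>s. W s / 2) has_real_derivative L s * W s) (at s)"
        unfolding W_def by (auto intro!: derivative_eq_intros deriv)
      then show "((\<lambda>s. W s / 2) has_vector_derivative L s * W s) (at s within {0..t})"
        by (simp add: has_real_derivative_iff_has_vector_derivative has_vector_derivative_at_within)
    qed
    then show ?thesis by (simp add: W_def zero diff_divide_distrib)
  qed
  define h where "h \<phi> s = f s (W s *\<^sub>R apply_bcontfun \<phi> s)" for \<phi> :: "(real, 'a) bcontfun" and s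
  have cont_h: "continuous_on {0..} (h \<phi>)" for \<phi>
  proof -
    have "continuous_on {0..} (\<lambda>s. (\<lambda>(t, x). f t x) (s, W s *\<^sub>R apply_bcontfun \<phi> s))"
      by (rule continuous_on_compose2[OF cont]) (auto intro!: continuous_intros cont_W)
    then show ?thesis by (simp add: h_def)
  qed
  have int_h: "h \<phi> integrable_on {0..t}" for \<phi> t
    by (rule integrable_continuous_real, rule continuous_on_subset[OF cont_h]) auto
  define J where "J \<phi> t = integral {0..t} (h \<phi>)" for \<phi> t
  have J_deriv: "(J \<phi> has_vector_derivative h \<phi> t) (at t within {0..})" if "0 \<le> t" for \<phi> t
  proof -
    have "(J \<phi> has_vector_derivative h \<phi> t) (at t within {0..t+1})"
      unfolding J_def
      by (rule integral_has_vector_derivative, rule continuous_on_subset[OF cont_h]) (use that in auto)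
    moreover have "at t within {0..t+1} = at t within {0..}"
      by (rule at_within_nhd[where S="{..<t+1}"]) auto
    ultimately show ?thesis by simp
  qed
  have cont_J: "continuous_on {0..} (J \<phi>)" for \<phi>
    by (meson J_deriv atLeast_iff continuous_on_eq_continuous_within has_vector_derivative_continuous)
  have J_diff: "norm (J \<phi> t - J \<psi> t) \<le> dist \<phi> \<psi> * ((W t - 1) / 2)" if "0 \<le> t" for \<phi> \<psi> t
  proof -
    have "norm (J \<phi> t - J \<psi> t) = norm (integral {0..t} (\<lambda>s. h \<phi> s - h \<psi> s))"
      unfolding J_def by (simp add: integral_diff int_h)
    also have "\<dots> \<le> integral {0..t} (\<lambda>s. dist \<phi> \<psi> * (L s * W s))"
    proof (rule integral_norm_bound_integral)
      show "(\<lambda>s. h \<phi> s - h \<psi> s) integrable_on {0..t}" by (intro integrable_diff int_h)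
      show "(\<lambda>s. dist \<phi> \<psi> * (L s * W s)) integrable_on {0..t}"
        using has_integral_mult_right[OF W_int[OF that], of "dist \<phi> \<psi>"] by (auto simp: integrable_on_def)
      fix s assume s: "s \<in> {0..t}"
      have "norm (h \<phi> s - h \<psi> s) \<le> L s * norm (W s *\<^sub>R apply_bcontfun \<phi> s - W s *\<^sub>R apply_bcontfun \<psi> s)"
        unfolding h_def by (rule lip) (use s in auto)
      also have "\<dots> = L s * W s * dist (apply_bcontfun \<phi> s) (apply_bcontfun \<psi> s)"
        using W_pos[of s] by (simp add: dist_norm flip: scaleR_diff_right)
      also have "\<dots> \<le> L s * W s * dist \<phi> \<psi>"
        by (intro mult_left_mono dist_bounded) (use L_nonneg W_pos[of s] s in auto)
      finally show "norm (h \<phi> s - h \<psi> s) \<le> dist \<phi> \<psi> * (L s * W s)" by (simp add: ac_simps)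
    qed
    also have "\<dots> = dist \<phi> \<psi> * ((W t - 1) / 2)"
      using has_integral_mult_right[OF W_int[OF that], of "dist \<phi> \<psi>"] by (rule integral_unique)
    finally show ?thesis .
  qed
  have J_zero: "norm (J 0 t) \<le> (W t - 1) / 2" if "0 \<le> t" for t
  proof -
    have "norm (J 0 t) \<le> integral {0..t} (\<lambda>s. L s * W s)"
      unfolding J_def
    proof (rule integral_norm_bound_integral[OF int_h])
      show "(\<lambda>s. L s * W s) integrable_on {0..t}" using W_int[OF that] by (auto simp: integrable_on_def)
      fix s assume s: "s \<in> {0..t}"
      have "norm (h 0 s) \<le> L s * 1" using bound[of s] s by (simp add: h_def)
      also have "\<dots> \<le> L s * W s"
        by (intro mult_left_mono) (use s L_nonneg \<Lambda>_nonneg in \<open>auto simp: W_def\<close>)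
      finally show "norm (h 0 s) \<le> L s * W s" .
    qed
    also have "\<dots> = (W t - 1) / 2" using W_int[OF that] by (rule integral_unique)
    finally show ?thesis .
  qed
  \<comment> \<open>Constant for negative times, since bounded continuous functions live on the whole line.\<close>
  define P where "P \<phi> t = (x0 + J \<phi> (max 0 t)) /\<^sub>R W (max 0 t)" for \<phi> t
  have P_bcontfun: "P \<phi> \<in> bcontfun" for \<phi>
  proof -
    have "continuous_on UNIV (P \<phi>)"
      unfolding P_def using W_pos
      by (intro continuous_intros continuous_on_compose2[OF cont_J] continuous_on_compose2[OF cont_W])
        (auto simp: less_imp_neq[symmetric])
    moreover have "norm (P \<phi> t) \<le> norm x0 + 1 + dist \<phi> 0" for t
    proof -
      define r where "r = max 0 t"
      have r: "0 \<le> r" by (simp add: r_def)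
      have W1: "1 \<le> W r" using \<Lambda>_nonneg[OF r] by (simp add: W_def)
      have "norm (x0 + J \<phi> r) \<le> norm x0 + (norm (J 0 r) + norm (J \<phi> r - J 0 r))"
        by norm
      also have "\<dots> \<le> norm x0 * W r + (1 * W r + dist \<phi> 0 * W r)"
      proof (intro add_mono)
        show "norm x0 \<le> norm x0 * W r" using W1 mult_left_mono[of 1 "W r" "norm x0"] by simp
        show "norm (J 0 r) \<le> 1 * W r"
        proof -
          have "(W r - 1) / 2 \<le> 1 * W r" using W1 by simp
          with J_zero[OF r] show ?thesis by (rule order_trans)
        qed
        have "norm (J \<phi> r - J 0 r) \<le> dist \<phi> 0 * ((W r - 1) / 2)" by (rule J_diff[OF r])
        also have "\<dots> \<le> dist \<phi> 0 * W r" by (intro mult_left_mono) (use W1 in auto)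
        finally show "norm (J \<phi> r - J 0 r) \<le> dist \<phi> 0 * W r" .
      qed
      finally have "norm (x0 + J \<phi> r) \<le> (norm x0 + 1 + dist \<phi> 0) * W r" by (simp add: algebra_simps)
      then show ?thesis using W_pos[of r] unfolding P_def r_def[symmetric]
        by (simp add: divide_simps mult.commute)
    qed
    ultimately show ?thesis unfolding bcontfun_def bounded_iff by blast
  qed
  have "\<exists>!\<phi>. Bcontfun (P \<phi>) = \<phi>"
  proof (rule banach_fix_type[of "1/2"], safe)
    fix \<phi> \<psi> :: "(real, 'a) bcontfun"
    show "dist (Bcontfun (P \<phi>)) (Bcontfun (P \<psi>)) \<le> 1 / 2 * dist \<phi> \<psi>"
    proof (rule dist_bound)
      fix t :: real
      define r where "r = max 0 t"
      have r: "0 \<le> r" by (simp add: r_def)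
      have "dist (P \<phi> t) (P \<psi> t) = norm (J \<phi> r - J \<psi> r) / W r"
        using W_pos[of r] unfolding P_def r_def[symmetric] dist_norm
        by (simp add: divide_simps flip: scaleR_diff_right)
      also have "\<dots> \<le> (dist \<phi> \<psi> * (W r / 2)) / W r"
      proof (rule divide_right_mono)
        show "norm (J \<phi> r - J \<psi> r) \<le> dist \<phi> \<psi> * (W r / 2)"
          by (rule order_trans[OF J_diff[OF r] mult_left_mono]) auto
      qed (use W_pos[of r] in auto)
      also have "\<dots> = 1 / 2 * dist \<phi> \<psi>" using W_pos[of r] by simp
      finally show "dist (apply_bcontfun (Bcontfun (P \<phi>)) t) (apply_bcontfun (Bcontfun (P \<psi>)) t)
          \<le> 1 / 2 * dist \<phi> \<psi>"
        by (simp add: Bcontfun_inverse P_bcontfun)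
    qed
  qed auto
  then obtain \<phi> where "Bcontfun (P \<phi>) = \<phi>" by blast
  then have fix_\<phi>: "apply_bcontfun \<phi> = P \<phi>" by (metis Bcontfun_inverse P_bcontfun)
  define x where "x t = x0 + J \<phi> t" for t
  have x_eq: "x t = W t *\<^sub>R apply_bcontfun \<phi> t" if "0 \<le> t" for t
    using that W_pos[of t] by (simp add: x_def fix_\<phi> P_def max_def)
  show thesis
  proof
    show "x 0 = x0" by (simp add: x_def J_def)
    fix t :: real assume t: "0 \<le> t"
    have "(x has_vector_derivative h \<phi> t) (at t within {0..})"
      unfolding x_def using J_deriv[OF t, of \<phi>] by (auto intro!: derivative_eq_intros)
    then show "(x has_vector_derivative f t (x t)) (at t within {0..})"
      by (simp add: h_def x_eq[OF t])
  qed
qed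

text \<open>
  The Lipschitz bound is only asked along the two given curves, which suits a field that is merely
  locally Lipschitz.  The squared distance, damped by \<open>e\<^bsup>-2Ls\<^esup>\<close>, cannot increase.
\<close>
lemma gronwall_unique:
  fixes x y x' y' :: "real \<Rightarrow> 'a::real_inner"
  assumes "0 \<le> \<tau>"
    and dx: "\<And>s. s \<in> {0..\<tau>} \<Longrightarrow> (x has_vector_derivative x' s) (at s within {0..\<tau>})"
    and dy: "\<And>s. s \<in> {0..\<tau>} \<Longrightarrow> (y has_vector_derivative y' s) (at s within {0..\<tau>})"
    and lip: "\<And>s. s \<in> {0..\<tau>} \<Longrightarrow> norm (x' s - y' s) \<le> L * norm (x s - y s)"
    and init: "x 0 = y 0"
  shows "x \<tau> = y \<tau>"
proof -
  define v where "v = (\<lambda>s. (x s - y s) \<bullet> (x s - y s))"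
  define u where "u s = exp (- (2 * L * s)) * v s" for s
  have du: "(u has_real_derivative exp (- (2 * L * s)) *
        (2 * ((x s - y s) \<bullet> (x' s - y' s)) - 2 * L * v s)) (at s within {0..\<tau>})"
    if "s \<in> {0..\<tau>}" for s
  proof -
    have d: "((\<lambda>s. x s - y s) has_vector_derivative x' s - y' s) (at s within {0..\<tau>})"
      by (intro has_vector_derivative_diff dx dy that)
    have "(v has_vector_derivative 2 * ((x s - y s) \<bullet> (x' s - y' s))) (at s within {0..\<tau>})"
      using bounded_bilinear.has_vector_derivative[OF bounded_bilinear_inner d d]
      unfolding v_def by (simp add: inner_commute)
    then have dv: "(v has_real_derivative 2 * ((x s - y s) \<bullet> (x' s - y' s))) (at s within {0..\<tau>})"
      by (simp add: has_real_derivative_iff_has_vector_derivative)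
    have de: "((\<lambda>s. exp (- (2 * L * s))) has_real_derivative - (2 * L) * exp (- (2 * L * s))) (at s within {0..\<tau>})"
      by (auto intro!: derivative_eq_intros)
    show ?thesis unfolding u_def
      using DERIV_mult[OF de dv] by (simp add: algebra_simps)
  qed
  have "u \<tau> \<le> u 0"
  proof (rule DERIV_nonpos_imp_decreasing_open[OF \<open>0 \<le> \<tau>\<close>])
    fix s assume s: "0 < s" "s < \<tau>"
    have "(x s - y s) \<bullet> (x' s - y' s) \<le> norm (x s - y s) * (L * norm (x s - y s))"
      by (rule order_trans[OF norm_cauchy_schwarz mult_left_mono[OF lip norm_ge_zero]]) (use s in auto)
    then have "(x s - y s) \<bullet> (x' s - y' s) \<le> L * v s"
      by (simp only: v_def dot_square_norm power2_eq_square mult.left_commute)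
    then have le: "2 * ((x s - y s) \<bullet> (x' s - y' s)) - 2 * L * v s \<le> 0" by linarith
    show "\<exists>d. (u has_real_derivative d) (at s) \<and> d \<le> 0"
    proof (intro exI conjI)
      show "(u has_real_derivative exp (- (2 * L * s)) *
        (2 * ((x s - y s) \<bullet> (x' s - y' s)) - 2 * L * v s)) (at s)"
        using du[of s] s at_within_Icc_at[of 0 s \<tau>] by simp
      show "exp (- (2 * L * s)) * (2 * ((x s - y s) \<bullet> (x' s - y' s)) - 2 * L * v s) \<le> 0"
        by (rule mult_nonneg_nonpos[OF _ le]) simp
    qed
  next
    show "continuous_on {0..\<tau>} u"
      by (rule DERIV_continuous_on, rule du)
  qed
  then have "exp (- (2 * L * \<tau>)) * ((x \<tau> - y \<tau>) \<bullet> (x \<tau> - y \<tau>)) \<le> 0"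
    by (simp add: u_def v_def init)
  then have "(x \<tau> - y \<tau>) \<bullet> (x \<tau> - y \<tau>) \<le> 0"
    by (simp add: mult_le_0_iff)
  then show ?thesis by (metis inner_gt_zero_iff not_le right_minus_eq)
qed

section \<open>The kernel and its moments\<close>

text \<open>
  The kernel \<open>e\<^bsup>-z\<^esup> / (y\<^sup>2 + e\<^bsup>-2z\<^esup>)\<^sup>2\<close>, multiplied through by \<open>e\<^bsup>4z\<^esup>\<close> so that only growing
  exponentials occur.
\<close>
definition kern :: "real \<Rightarrow> real \<Rightarrow> real" where
  "kern y z = exp (3 * z) / (1 + (y * exp z)\<^sup>2)\<^sup>2"

definition moment :: "nat \<Rightarrow> (real \<Rightarrow> real) \<Rightarrow> real" where
  "moment n g = integral {0..1} (\<lambda>y. y ^ n * kern y (g y))"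

lemma ode_integrand_kern:
  "ode_integrand K g x y = y * kern y (g y) - x / K * kern y (g y)"
proof -
  define e where "e = exp (g y)"
  have e: "0 < e" by (simp add: e_def)
  have pos: "0 < 1 + (y * e)\<^sup>2" by (simp add: add_pos_nonneg)
  have e1: "exp (- g y) = 1 / e" by (simp add: e_def exp_minus divide_inverse)
  have e2: "exp (- 2 * g y) = 1 / e\<^sup>2"
    using exp_double[of "- g y"] by (simp add: e1 power_divide)
  have e3: "exp (3 * g y) = e ^ 3" by (metis e_def exp_of_nat_mult of_nat_numeral)
  have "y\<^sup>2 + 1 / e\<^sup>2 = (1 + (y * e)\<^sup>2) / e\<^sup>2"
    using e by (simp add: field_simps power2_eq_square)
  then have "exp (- g y) / (y\<^sup>2 + exp (- 2 * g y))\<^sup>2 = (1 / e) / ((1 + (y * e)\<^sup>2) / e\<^sup>2)\<^sup>2"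
    by (simp only: e1 e2)
  also have "\<dots> = e ^ 3 / (1 + (y * e)\<^sup>2)\<^sup>2"
    using e pos by (simp add: power_divide divide_simps) (simp add: power2_eq_square power3_eq_cube power4_eq_xxxx)
  finally have "exp (- g y) / (y\<^sup>2 + exp (- 2 * g y))\<^sup>2 = kern y (g y)"
    by (simp add: kern_def e3 flip: e_def)
  then have "(y - x / K) * (exp (- g y) / (y\<^sup>2 + exp (- 2 * g y))\<^sup>2) = (y - x / K) * kern y (g y)"
    by simp
  then show ?thesis
    by (simp add: ode_integrand_def algebra_simps divide_inverse)
qed

lemma one_plus_square_pos: "0 < 1 + (u::real)\<^sup>2"
  by (simp add: add_pos_nonneg)

lemma one_plus_square_neq_0 [simp]: "1 + (u::real)\<^sup>2 \<noteq> 0"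
  using one_plus_square_pos[of u] by linarith

lemma kern_pos: "0 < kern y z"
  by (simp add: kern_def)

lemma kern_le_exp: "kern y z \<le> exp (3 * z)"
proof -
  have "1 \<le> (1 + (y * exp z)\<^sup>2)\<^sup>2" by (rule one_le_power) simp
  then show ?thesis by (simp add: kern_def divide_le_eq_1 divide_simps one_plus_square_pos)
qed

lemma continuous_on_kern [continuous_intros]:
  assumes "continuous_on S f" "continuous_on S g"
  shows "continuous_on S (\<lambda>x. kern (f x) (g x))"
  unfolding kern_def using one_plus_square_pos
  by (intro continuous_intros assms) (auto simp: less_imp_neq[symmetric])

lemma kern_deriv:
  "((\<lambda>z. kern y z) has_real_derivative
     kern y z * (3 - 4 * ((y * exp z)\<^sup>2 / (1 + (y * exp z)\<^sup>2)))) (at z)"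
proof -
  define q where "q = 1 + (y * exp z)\<^sup>2"
  have q: "0 < q" by (simp add: q_def one_plus_square_pos)
  have dq: "((\<lambda>z. 1 + (y * exp z)\<^sup>2) has_real_derivative 2 * (y * exp z)\<^sup>2) (at z)"
    by (auto intro!: derivative_eq_intros simp: power2_eq_square)
  have dn: "((\<lambda>z. exp (3 * z)) has_real_derivative 3 * exp (3 * z)) (at z)"
    by (auto intro!: derivative_eq_intros)
  have dq2: "((\<lambda>z. (1 + (y * exp z)\<^sup>2)\<^sup>2) has_real_derivative 2 * q * (2 * (y * exp z)\<^sup>2)) (at z)"
    by (rule derivative_eq_intros dq refl)+ (simp add: q_def)
  have "((\<lambda>z. kern y z) has_real_derivative
      (3 * exp (3 * z) * q\<^sup>2 - exp (3 * z) * (2 * q * (2 * (y * exp z)\<^sup>2))) / (q\<^sup>2 * q\<^sup>2)) (at z)"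
    unfolding kern_def using DERIV_divide[OF dn dq2] q by (simp add: q_def)
  moreover have "(3 * exp (3 * z) * q\<^sup>2 - exp (3 * z) * (2 * q * (2 * (y * exp z)\<^sup>2))) / (q\<^sup>2 * q\<^sup>2)
      = exp (3 * z) / q\<^sup>2 * (3 - 4 * ((y * exp z)\<^sup>2 / q))"
    using q by (simp add: field_simps power2_eq_square)
  ultimately show ?thesis by (simp add: kern_def q_def)
qed

text \<open>
  The logarithmic derivative of the kernel in \<open>z\<close> is \<open>3 - 4 s\<close> with \<open>s\<close> in \<open>[0,1)\<close>, so the derivative is
  at most three times the kernel, and the kernel is at most \<open>e\<^bsup>3N\<^esup>\<close>.
\<close>
lemma kern_lipschitz:
  assumes "z \<le> N" "z' \<le> N"
  shows "\<bar>kern y z - kern y z'\<bar> \<le> 3 * exp (3 * N) * \<bar>z - z'\<bar>"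
proof -
  have "norm (kern y z - kern y z') \<le> 3 * exp (3 * N) * norm (z - z')"
  proof (rule field_differentiable_bound[of "{..N}"])
    fix w assume "w \<in> {..N}"
    show "((\<lambda>z. kern y z) has_field_derivative
     kern y w * (3 - 4 * ((y * exp w)\<^sup>2 / (1 + (y * exp w)\<^sup>2)))) (at w within {..N})"
      by (rule has_field_derivative_at_within[OF kern_deriv])
    define s where "s = (y * exp w)\<^sup>2 / (1 + (y * exp w)\<^sup>2)"
    have "0 \<le> s" "s \<le> 1"
      by (simp_all add: s_def divide_le_eq_1 add_pos_nonneg)
    then have "\<bar>3 - 4 * s\<bar> \<le> 3" by (auto simp: abs_if)
    moreover have "\<bar>kern y w\<bar> \<le> exp (3 * N)"
      using kern_le_exp[of y w] kern_pos[of y w] \<open>w \<in> {..N}\<close>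
      by (auto intro: order_trans)
    ultimately have "\<bar>kern y w\<bar> * \<bar>3 - 4 * s\<bar> \<le> exp (3 * N) * 3"
      by (intro mult_mono) auto
    then show "norm (kern y w * (3 - 4 * ((y * exp w)\<^sup>2 / (1 + (y * exp w)\<^sup>2)))) \<le> 3 * exp (3 * N)"
      by (simp add: s_def abs_mult)
  qed (use assms in auto)
  then show ?thesis by simp
qed

lemma moment_integrable:
  assumes "continuous_on {0..1} g"
  shows "(\<lambda>y. y ^ n * kern y (g y)) integrable_on {0..1}"
  by (intro integrable_continuous_real continuous_intros assms)

lemma moment_has_integral:
  assumes "continuous_on {0..1} g"
  shows "((\<lambda>y. y ^ n * kern y (g y)) has_integral moment n g) {0..1}"
  unfolding moment_def by (rule integrable_integral[OF moment_integrable[OF assms]])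

lemma moment_nonneg: "0 \<le> moment n g"
  unfolding moment_def
  by (cases "(\<lambda>y. y ^ n * kern y (g y)) integrable_on {0..1}")
    (auto intro!: integral_nonneg mult_nonneg_nonneg less_imp_le[OF kern_pos] simp: not_integrable_integral)

lemma moment0_pos:
  assumes "continuous_on {0..1} g"
  shows "0 < moment 0 g"
proof -
  obtain y0 where y0: "\<forall>y\<in>{0..1}. kern y0 (g y0) \<le> kern y (g y)"
    using continuous_attains_inf[OF compact_Icc _ continuous_on_kern[OF continuous_on_id assms]] by auto
  have "((\<lambda>y::real. kern y0 (g y0)) has_integral kern y0 (g y0)) {0..1}"
    using has_integral_const_real[of "kern y0 (g y0)" 0 1] by simp
  then have "kern y0 (g y0) \<le> moment 0 g"
    by (rule has_integral_le[OF _ moment_has_integral[OF assms]]) (simp add: y0)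
  then show ?thesis using kern_pos[of y0 "g y0"] by linarith
qed

lemma moment_antimono:
  assumes "continuous_on {0..1} g" "m \<le> n"
  shows "moment n g \<le> moment m g"
  unfolding moment_def
  by (intro integral_le moment_integrable mult_right_mono power_decreasing less_imp_le[OF kern_pos])
    (use assms in auto)

lemma moment_lipschitz:
  assumes "continuous_on {0..1} g" "continuous_on {0..1} h"
    and "\<And>y. y \<in> {0..1} \<Longrightarrow> g y \<le> N" "\<And>y. y \<in> {0..1} \<Longrightarrow> h y \<le> N"
    and "\<And>y. y \<in> {0..1} \<Longrightarrow> \<bar>g y - h y\<bar> \<le> d"
  shows "\<bar>moment n g - moment n h\<bar> \<le> 3 * exp (3 * N) * d"
proof -
  have "norm (integral {0..1} (\<lambda>y. y ^ n * kern y (g y) - y ^ n * kern y (h y)))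
      \<le> 3 * exp (3 * N) * d * (1 - 0)"
  proof (rule integral_bound)
    fix y :: real assume y: "y \<in> {0..1}"
    have "norm (y ^ n * kern y (g y) - y ^ n * kern y (h y)) = y ^ n * \<bar>kern y (g y) - kern y (h y)\<bar>"
      using y by (simp add: abs_mult flip: right_diff_distrib)
    also have "\<dots> \<le> 1 * (3 * exp (3 * N) * d)"
    proof (rule mult_mono)
      show "y ^ n \<le> 1" using y by (simp add: power_le_one)
      have "\<bar>kern y (g y) - kern y (h y)\<bar> \<le> 3 * exp (3 * N) * \<bar>g y - h y\<bar>"
        by (rule kern_lipschitz) (use assms y in auto)
      also have "\<dots> \<le> 3 * exp (3 * N) * d" by (intro mult_left_mono assms) (use y in auto)
      finally show "\<bar>kern y (g y) - kern y (h y)\<bar> \<le> 3 * exp (3 * N) * d" .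
    qed auto
    finally show "norm (y ^ n * kern y (g y) - y ^ n * kern y (h y)) \<le> 3 * exp (3 * N) * d" by simp
  qed (auto intro!: continuous_intros assms)
  then show ?thesis
    by (simp add: moment_def integral_diff moment_integrable assms)
qed

lemma moment_le_exp:
  assumes "continuous_on {0..1} g" "\<And>y. y \<in> {0..1} \<Longrightarrow> g y \<le> N"
  shows "moment n g \<le> exp (3 * N)"
proof -
  have "moment n g \<le> integral {0..1} (\<lambda>y::real. exp (3 * N))"
    unfolding moment_def
  proof (rule integral_le)
    fix y :: real assume y: "y \<in> {0..1}"
    have "y ^ n * kern y (g y) \<le> 1 * exp (3 * N)"
    proof (rule mult_mono)
      show "kern y (g y) \<le> exp (3 * N)"
        using kern_le_exp[of y "g y"] assms(2)[OF y] by (auto intro: order_trans)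
    qed (use y in \<open>auto simp: power_le_one less_imp_le[OF kern_pos]\<close>)
    then show "y ^ n * kern y (g y) \<le> exp (3 * N)" by simp
  qed (auto intro!: moment_integrable assms)
  then show ?thesis by simp
qed

lemma continuous_on_moment:
  assumes "continuous_on (U \<times> {0..1}) (\<lambda>(p, y). g p y)"
  shows "continuous_on U (\<lambda>p. moment n (g p))"
proof -
  have "continuous_on (U \<times> cbox 0 1) (\<lambda>(p, y). y ^ n * kern y (g p y))"
    using assms by (auto simp: split_beta intro!: continuous_intros)
  then show ?thesis unfolding moment_def using integral_continuous_on_param by fastforce
qed

section \<open>Moments of affine profiles\<close>

abbreviation (input) lin :: "real \<Rightarrow> real \<Rightarrow> real \<Rightarrow> real" where
  "lin a b y \<equiv> a - b * y"

lemma continuous_on_lin: "continuous_on S (lin a b)"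
  by (intro continuous_intros)

lemma exp_decay_has_integral:
  fixes c a b :: real
  assumes "0 < c" "0 < b"
  shows "((\<lambda>y. exp (a - c * b * y)) has_integral exp a * (1 - exp (- (c * b))) / (c * b)) {0..1}"
proof -
  have "((\<lambda>y. exp (a - c * b * y)) has_integral
      (- exp (a - c * b * 1) / (c * b)) - (- exp (a - c * b * 0) / (c * b))) {0..1}"
  proof (rule fundamental_theorem_of_calculus)
    fix y :: real
    have "((\<lambda>y. - exp (a - c * b * y) / (c * b)) has_real_derivative exp (a - c * b * y)) (at y within {0..1})"
      using assms by (auto intro!: derivative_eq_intros)
    then show "((\<lambda>y. - exp (a - c * b * y) / (c * b)) has_vector_derivative exp (a - c * b * y)) (at y within {0..1})"
      by (simp add: has_real_derivative_iff_has_vector_derivative)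
  qed simp
  moreover have "(- exp (a - c * b * 1) / (c * b)) - (- exp (a - c * b * 0) / (c * b))
      = exp a * (1 - exp (- (c * b))) / (c * b)"
    using assms by (simp add: exp_diff exp_minus field_simps)
  ultimately show ?thesis by (simp only:)
qed

lemma kern_lin_cube: "exp (3 * lin a b y) = exp (3 * a - 3 * b * y)"
  by (simp add: algebra_simps)

lemma moment0_upper:
  assumes "0 < b"
  shows "3 * b * moment 0 (lin a b) \<le> exp (3 * a)"
proof -
  have "moment 0 (lin a b) \<le> exp (3 * a) * (1 - exp (- (3 * b))) / (3 * b)"
  proof (rule has_integral_le[OF moment_has_integral[OF continuous_on_lin] exp_decay_has_integral])
    fix y :: real
    show "y ^ 0 * kern y (lin a b y) \<le> exp (3 * a - 3 * b * y)"
      using kern_le_exp[of y "lin a b y"] unfolding kern_lin_cube by simp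
  qed (use assms in auto)
  also have "\<dots> \<le> exp (3 * a) / (3 * b)"
    using assms by (intro divide_right_mono) (auto simp: mult_le_cancel_left1)
  finally show ?thesis using assms by (simp add: field_simps)
qed

text \<open>
  Since \<open>b y \<le> e\<^bsup>by\<^esup>\<close>, the quantity \<open>y e\<^bsup>a-by\<^esup>\<close> is at most \<open>e\<^sup>a / b\<close> uniformly in \<open>y\<close>; thus the denominator of
  the kernel is bounded once \<open>e\<^sup>a / b\<close> is, and the moment is of the same order as in \<open>moment0_upper\<close>.
\<close>
lemma moment0_lower:
  assumes "0 < b"
  shows "exp (3 * a) * (1 - exp (- (3 * b))) / (3 * b) / (1 + (exp a / b)\<^sup>2)\<^sup>2 \<le> moment 0 (lin a b)"
proof (rule has_integral_le[OF has_integral_divide[OF exp_decay_has_integral] moment_has_integral[OF continuous_on_lin]])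
  fix y :: real assume y: "y \<in> {0..1}"
  have "b * y \<le> exp (b * y)" using exp_ge_add_one_self[of "b * y"] by linarith
  then have "y * exp (lin a b y) \<le> exp a / b"
    using assms by (simp add: exp_diff field_simps)
  then have "(y * exp (lin a b y))\<^sup>2 \<le> (exp a / b)\<^sup>2"
    using y by (intro power_mono) auto
  then have "(1 + (y * exp (lin a b y))\<^sup>2)\<^sup>2 \<le> (1 + (exp a / b)\<^sup>2)\<^sup>2"
    by (intro power_mono) auto
  then show "exp (3 * a - 3 * b * y) / (1 + (exp a / b)\<^sup>2)\<^sup>2 \<le> y ^ 0 * kern y (lin a b y)"
    unfolding kern_lin_cube[symmetric]
    by (auto simp: kern_def intro!: divide_left_mono mult_pos_pos zero_less_power one_plus_square_pos)
qed (use assms in auto)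

text \<open>
  With \<open>p = (y g)\<^sup>2\<close>, the numerator contributes \<open>k (1 + p) (1 - 3 b y)\<close> and the denominator
  \<open>- 2 p k (1 - b y)\<close>.  The first power of \<open>1 + p\<close> is chosen because their sum then differs from
  \<open>k (1 - 3 b y)\<close> by a term of fixed sign, \<open>- p k (1 + b y)\<close>.
\<close>
lemma virial_deriv:
  fixes a b y :: real
  defines "g \<equiv> exp (lin a b y)"
  shows "((\<lambda>y. y * exp (3 * lin a b y) / (1 + (y * exp (lin a b y))\<^sup>2)) has_real_derivative
     kern y (lin a b y) * (1 - 3 * b * y - (y * g)\<^sup>2 * (1 + b * y))) (at y within S)"
proof -
  define q where "q = 1 + (y * g)\<^sup>2"
  have q: "0 < q" by (simp add: q_def one_plus_square_pos)
  have dq: "((\<lambda>y. 1 + (y * exp (lin a b y))\<^sup>2) has_real_derivative 2 * (y * g) * (g - b * (y * g))) (at y within S)"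
    by (rule derivative_eq_intros refl)+ (simp add: g_def algebra_simps)
  have dn: "((\<lambda>y. y * exp (3 * lin a b y)) has_real_derivative
      exp (3 * lin a b y) * (1 - 3 * b * y)) (at y within S)"
    by (rule derivative_eq_intros refl)+ (simp add: algebra_simps)
  have "((\<lambda>y. y * exp (3 * lin a b y) / (1 + (y * exp (lin a b y))\<^sup>2)) has_real_derivative
      (exp (3 * lin a b y) * (1 - 3 * b * y) * q - y * exp (3 * lin a b y) * (2 * (y * g) * (g - b * (y * g)))) / (q * q))
      (at y within S)"
    using DERIV_divide[OF dn dq] q by (simp add: q_def g_def)
  moreover have "(exp (3 * lin a b y) * (1 - 3 * b * y) * q - y * exp (3 * lin a b y) * (2 * (y * g) * (g - b * (y * g)))) / (q * q)
     = exp (3 * lin a b y) / q\<^sup>2 * (1 - 3 * b * y - (y * g)\<^sup>2 * (1 + b * y))"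
    by (simp add: q_def power2_eq_square algebra_simps)
  ultimately show ?thesis by (simp add: kern_def q_def g_def)
qed

text \<open>
  The value of the integral is the defect in \<open>3 b m\<^sub>1 \<le> m\<^sub>0\<close>, up to a nonnegative boundary term from
  \<open>y = 1\<close>.  The inequality is nearly an equality when \<open>b\<close> is large and \<open>e\<^sup>a / b\<close> is small, because the
  kernel is then close to \<open>e\<^bsup>3(a-by)\<^esup>\<close>, for which the mean of \<open>y\<close> is about \<open>1/(3b)\<close>.
\<close>
lemma virial_identity:
  "((\<lambda>y. kern y (lin a b y) * ((y * exp (lin a b y))\<^sup>2 * (1 + b * y))) has_integral
     (moment 0 (lin a b) - 3 * b * moment 1 (lin a b) - exp (3 * (a - b)) / (1 + (exp (a - b))\<^sup>2))) {0..1}"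
proof -
  have v: "((\<lambda>y. kern y (lin a b y) * (1 - 3 * b * y - (y * exp (lin a b y))\<^sup>2 * (1 + b * y))) has_integral
      (1 * exp (3 * lin a b 1) / (1 + (1 * exp (lin a b 1))\<^sup>2) - 0 * exp (3 * lin a b 0) / (1 + (0 * exp (lin a b 0))\<^sup>2))) {0..1}"
    by (rule fundamental_theorem_of_calculus)
      (use virial_deriv in \<open>auto simp flip: has_real_derivative_iff_has_vector_derivative\<close>)
  have "((\<lambda>y. y ^ 0 * kern y (lin a b y) - 3 * b * (y ^ 1 * kern y (lin a b y))
      - kern y (lin a b y) * (1 - 3 * b * y - (y * exp (lin a b y))\<^sup>2 * (1 + b * y))) has_integral
      (moment 0 (lin a b) - 3 * b * moment 1 (lin a b)
      - (1 * exp (3 * lin a b 1) / (1 + (1 * exp (lin a b 1))\<^sup>2) - 0 * exp (3 * lin a b 0) / (1 + (0 * exp (lin a b 0))\<^sup>2)))) {0..1}"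
    by (intro has_integral_diff has_integral_mult_right moment_has_integral continuous_on_lin v)
  then show ?thesis by (simp add: algebra_simps)
qed

lemma moment1_upper:
  assumes "0 \<le> b"
  shows "3 * b * moment 1 (lin a b) \<le> moment 0 (lin a b)"
proof -
  have "0 \<le> moment 0 (lin a b) - 3 * b * moment 1 (lin a b) - exp (3 * (a - b)) / (1 + (exp (a - b))\<^sup>2)"
    by (rule has_integral_nonneg[OF virial_identity])
      (use assms in \<open>auto intro!: mult_nonneg_nonneg less_imp_le[OF kern_pos]\<close>)
  moreover have "0 \<le> exp (3 * (a - b)) / (1 + (exp (a - b))\<^sup>2)" by simp
  ultimately show ?thesis by linarith
qed

text \<open>
  In the virial identity the kernel is replaced by \<open>e\<^bsup>3(a-by)\<^esup>\<close>.  With \<open>v = b y\<close> the remaining integrand is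
  \<open>e\<^bsup>5a\<^esup> b\<^bsup>-2\<^esup> v\<^sup>2 (1 + v) e\<^bsup>-5v\<^esup>\<close>, and \<open>v\<^sup>2 (1 + v) \<le> e\<^bsup>3v\<^esup>\<close> reduces it to a plain exponential.
\<close>
lemma moment1_lower:
  assumes "0 < b"
  shows "moment 0 (lin a b) - 3 * b * moment 1 (lin a b) \<le> exp (3 * a) * (exp (- (3 * b)) + exp (2 * a) / (2 * b ^ 3))"
proof -
  have "moment 0 (lin a b) - 3 * b * moment 1 (lin a b) - exp (3 * (a - b)) / (1 + (exp (a - b))\<^sup>2)
      \<le> exp (5 * a) * (1 - exp (- (2 * b))) / (2 * b) / b\<^sup>2"
  proof (rule has_integral_le[OF virial_identity])
    have "((\<lambda>y. exp (5 * a - 2 * b * y) / b\<^sup>2) has_integral exp (5 * a) * (1 - exp (- (2 * b))) / (2 * b) / b\<^sup>2) {0..1}"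
      by (intro has_integral_divide exp_decay_has_integral) (use assms in auto)
    then show "((\<lambda>y. exp (5 * a - 2 * b * y) / b\<^sup>2) has_integral exp (5 * a) * (1 - exp (- (2 * b))) / (2 * b) / b\<^sup>2) {0..1}" .
    fix y :: real assume y: "y \<in> {0..1}"
    define v where "v = b * y"
    have v: "0 \<le> v" using y assms by (simp add: v_def)
    have "1 + v \<le> exp v" by (rule exp_ge_add_one_self)
    moreover from this have "v \<le> exp v" by linarith
    ultimately have "v\<^sup>2 * (1 + v) \<le> (exp v)\<^sup>2 * exp v" using v by (intro mult_mono power_mono) auto
    also have "\<dots> = exp (3 * v)" by (simp add: power2_eq_square flip: exp_add)
    finally have v3: "v\<^sup>2 * (1 + v) \<le> exp (3 * v)" .
    have "kern y (lin a b y) * ((y * exp (lin a b y))\<^sup>2 * (1 + b * y))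
        \<le> exp (3 * lin a b y) * ((y * exp (lin a b y))\<^sup>2 * (1 + b * y))"
      by (intro mult_right_mono kern_le_exp) (use y assms in auto)
    also have "\<dots> = exp (3 * (a - v) + 2 * (a - v)) * (y\<^sup>2 * (1 + v))"
      unfolding exp_add exp_double v_def by (simp add: power_mult_distrib)
    also have "\<dots> = exp (5 * a - 5 * v) * (v\<^sup>2 * (1 + v)) / b\<^sup>2"
    proof -
      have "v\<^sup>2 / b\<^sup>2 = y\<^sup>2" using assms by (simp add: v_def power_mult_distrib)
      moreover have "3 * (a - v) + 2 * (a - v) = 5 * a - 5 * v" by simp
      ultimately show ?thesis by (metis times_divide_eq_left times_divide_eq_right)
    qed
    also have "\<dots> \<le> exp (5 * a - 5 * v) * exp (3 * v) / b\<^sup>2"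
      by (intro divide_right_mono mult_left_mono v3) auto
    also have "\<dots> = exp (5 * a - 2 * b * y) / b\<^sup>2"
      by (simp add: v_def algebra_simps flip: exp_add)
    finally show "kern y (lin a b y) * ((y * exp (lin a b y))\<^sup>2 * (1 + b * y)) \<le> exp (5 * a - 2 * b * y) / b\<^sup>2" .
  qed
  also have "\<dots> \<le> exp (5 * a) / (2 * b) / b\<^sup>2"
    using assms by (intro divide_right_mono) (auto simp: mult_le_cancel_left1)
  also have "\<dots> = exp (3 * a) * (exp (2 * a) / (2 * b ^ 3))"
    by (simp add: power2_eq_square power3_eq_cube flip: exp_add)
  finally have "moment 0 (lin a b) - 3 * b * moment 1 (lin a b)
      \<le> exp (3 * (a - b)) / (1 + (exp (a - b))\<^sup>2) + exp (3 * a) * (exp (2 * a) / (2 * b ^ 3))" by simp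
  also have "exp (3 * (a - b)) / (1 + (exp (a - b))\<^sup>2) \<le> exp (3 * (a - b))"
    by (simp add: divide_le_eq one_plus_square_pos mult_le_cancel_left1)
  also have "exp (3 * (a - b)) = exp (3 * a) * exp (- (3 * b))"
    by (simp add: algebra_simps flip: exp_add)
  finally show ?thesis by (simp add: algebra_simps)
qed

section \<open>Reduction to a planar system\<close>

lemma has_integral_ode_integrand:
  assumes "\<And>y. y \<in> {0..1} \<Longrightarrow> g y = lin a b y"
  shows "(ode_integrand K g x has_integral moment 1 (lin a b) - x / K * moment 0 (lin a b)) {0..1}"
proof -
  have "((\<lambda>y. y ^ 1 * kern y (lin a b y) - x / K * (y ^ 0 * kern y (lin a b y))) has_integral
      moment 1 (lin a b) - x / K * moment 0 (lin a b)) {0..1}"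
    by (intro has_integral_diff has_integral_mult_right moment_has_integral continuous_on_lin)
  then show ?thesis
    by (rule has_integral_eq[rotated]) (simp add: ode_integrand_kern assms)
qed

text \<open>
  The right-hand side of the equation at \<open>x\<close> is the interpolation \<open>(1 - x) I(0) + x I(1)\<close> of its values at the
  end points, whatever the solution looks like in \<open>y\<close>.  So the deviation of \<open>H\<close> from its linear
  interpolation in \<open>x\<close> is constant in time, and it vanishes at time \<open>0\<close>.
\<close>
lemma ode_solution_affine:
  assumes sol: "ode_solution K J H" and J: "convex J" "0 \<in> J" and x: "x \<in> {0..1}" and t: "t \<in> J"
  shows "H x t = lin (H 0 t) (H 0 t - H 1 t) x"
proof -
  define I where "I z s = integral {0..1} (ode_integrand K (\<lambda>y. H y s) z)" for z s
  have int: "ode_integrand K (\<lambda>y. H y s) z integrable_on {0..1}"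
    and deriv: "(H z has_real_derivative I z s) (at s within J)" if "s \<in> J" "z \<in> {0..1}" for s z
    using sol that by (auto simp: ode_solution_def I_def)
  have I_affine: "I x s = (1 - x) * I 0 s + x * I 1 s" if "s \<in> J" for s
  proof -
    have "ode_integrand K (\<lambda>y. H y s) x y =
        (1 - x) * ode_integrand K (\<lambda>y. H y s) 0 y + x * ode_integrand K (\<lambda>y. H y s) 1 y" for y
      by (simp add: ode_integrand_kern algebra_simps)
    then have "I x s = integral {0..1} (\<lambda>y. (1 - x) * ode_integrand K (\<lambda>y. H y s) 0 y
        + x * ode_integrand K (\<lambda>y. H y s) 1 y)"
      unfolding I_def by (intro integral_cong) auto
    also have "\<dots> = (1 - x) * I 0 s + x * I 1 s"
      unfolding I_def using int[OF that, of 0] int[OF that, of 1]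
      by (intro integral_unique has_integral_add has_integral_mult_right integrable_integral) auto
    finally show ?thesis .
  qed
  define d where "d s = H x s - ((1 - x) * H 0 s + x * H 1 s)" for s
  have "(d has_real_derivative 0) (at s within J)" if "s \<in> J" for s
  proof -
    have "(d has_real_derivative I x s - ((1 - x) * I 0 s + x * I 1 s)) (at s within J)"
      unfolding d_def
      by (intro DERIV_diff DERIV_add DERIV_cmult deriv that x) auto
    then show ?thesis by (simp add: I_affine[OF that])
  qed
  then obtain c where c: "\<And>s. s \<in> J \<Longrightarrow> d s = c"
    using has_field_derivative_zero_constant[OF J(1)] by metis
  have "d 0 = 0" using sol x by (simp add: d_def ode_solution_def)
  then have "d t = 0" using c J(2) t by simp
  then show ?thesis by (simp add: d_def algebra_simps)
qed

lemma ode_solution_profile_derivs: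
  assumes sol: "ode_solution K J H" and J: "convex J" "0 \<in> J" and t: "t \<in> J"
  defines "A \<equiv> H 0" and "B \<equiv> \<lambda>t. H 0 t - H 1 t"
  shows "(A has_real_derivative moment 1 (lin (A t) (B t))) (at t within J)"
    and "(B has_real_derivative moment 0 (lin (A t) (B t)) / K) (at t within J)"
proof -
  have rhs: "integral {0..1} (ode_integrand K (\<lambda>y. H y t) x)
      = moment 1 (lin (A t) (B t)) - x / K * moment 0 (lin (A t) (B t))" for x
    by (intro integral_unique has_integral_ode_integrand)
      (unfold A_def B_def, rule ode_solution_affine[OF sol J _ t])
  have deriv: "(H x has_real_derivative moment 1 (lin (A t) (B t)) - x / K * moment 0 (lin (A t) (B t))) (at t within J)"
    if "x \<in> {0..1}" for x
  proof -
    have "(H x has_real_derivative integral {0..1} (ode_integrand K (\<lambda>y. H y t) x)) (at t within J)"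
      using sol t that by (simp add: ode_solution_def)
    then show ?thesis by (simp only: rhs)
  qed
  show "(A has_real_derivative moment 1 (lin (A t) (B t))) (at t within J)"
    using deriv[of 0] by (simp add: A_def)
  show "(B has_real_derivative moment 0 (lin (A t) (B t)) / K) (at t within J)"
    using DERIV_diff[OF deriv[of 0] deriv[of 1]] by (simp add: B_def)
qed

text \<open>
  The vector field of the planar system for \<open>p = (A, B)\<close>, with the exponent cut off at \<open>N\<close>.  Cutting the
  exponent rather than \<open>A\<close> and \<open>B\<close> gives a global Lipschitz constant and leaves the field positive.
\<close>
definition trunc_field :: "real \<Rightarrow> real \<Rightarrow> real \<times> real \<Rightarrow> real \<times> real" where
  "trunc_field K N p =
     (moment 1 (\<lambda>y. min (lin (fst p) (snd p) y) N), moment 0 (\<lambda>y. min (lin (fst p) (snd p) y) N) / K)"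

lemma trunc_field_eq:
  assumes "\<And>y. y \<in> {0..1} \<Longrightarrow> lin a b y \<le> N"
  shows "trunc_field K N (a, b) = (moment 1 (lin a b), moment 0 (lin a b) / K)"
  unfolding trunc_field_def moment_def
  by (auto intro!: integral_cong simp: min_absorb1 assms)

lemma continuous_on_trunc_profile: "continuous_on S (\<lambda>y. min (lin a b y) N)"
  by (intro continuous_intros)

lemma norm_field_le:
  fixes u v d :: real
  assumes "1 \<le> K" "\<bar>u\<bar> \<le> d" "\<bar>v\<bar> \<le> d"
  shows "norm (u, v / K) \<le> 2 * d"
proof -
  have "\<bar>v / K\<bar> \<le> \<bar>v\<bar>" using assms(1) by (simp add: abs_divide divide_le_eq mult_le_cancel_left1)
  then show ?thesis using norm_Pair_le[of u "v / K"] assms by simp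
qed

lemma trunc_field_lipschitz:
  assumes "1 \<le> K"
  shows "norm (trunc_field K N p - trunc_field K N q) \<le> 12 * exp (3 * N) * norm (p - q)"
proof -
  define d where "d = 2 * norm (p - q)"
  have "\<bar>min (lin (fst p) (snd p) y) N - min (lin (fst q) (snd q) y) N\<bar> \<le> d" if "y \<in> {0..1}" for y
  proof -
    have "\<bar>min (lin (fst p) (snd p) y) N - min (lin (fst q) (snd q) y) N\<bar>
        \<le> \<bar>fst (p - q) - snd (p - q) * y\<bar>" by (simp add: algebra_simps)
    also have "\<dots> \<le> \<bar>fst (p - q)\<bar> + \<bar>snd (p - q)\<bar> * 1"
      using that mult_left_mono[of y 1 "\<bar>snd (p - q)\<bar>"] abs_triangle_ineq4[of "fst (p - q)" "snd (p - q) * y"]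
      by (auto simp: abs_mult)
    also have "\<dots> \<le> d"
      using norm_fst_le[of "fst (p - q)" "snd (p - q)"] norm_snd_le[of "snd (p - q)" "fst (p - q)"]
      unfolding d_def prod.collapse real_norm_def by linarith
    finally show ?thesis .
  qed
  then have "\<bar>moment n (\<lambda>y. min (lin (fst p) (snd p) y) N) - moment n (\<lambda>y. min (lin (fst q) (snd q) y) N)\<bar>
      \<le> 3 * exp (3 * N) * d" for n
    by (intro moment_lipschitz continuous_on_trunc_profile) auto
  then have "norm (trunc_field K N p - trunc_field K N q) \<le> 2 * (3 * exp (3 * N) * d)"
    using norm_field_le[OF assms] unfolding trunc_field_def diff_Pair diff_divide_distrib[symmetric]
    by blast
  then show ?thesis by (simp add: d_def)
qed

lemma trunc_field_bound:
  assumes "1 \<le> K"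
  shows "norm (trunc_field K N p) \<le> 2 * exp (3 * N)"
  unfolding trunc_field_def
  by (intro norm_field_le assms) (auto simp: moment_nonneg intro!: moment_le_exp continuous_on_trunc_profile)

text \<open>
  Both solutions are bounded on the compact time interval, so there they solve the equation of one truncated
  field, which is Lipschitz.
\<close>
lemma profile_unique:
  fixes A B A' B' :: "real \<Rightarrow> real"
  assumes "1 \<le> K" "0 \<le> \<tau>"
    and A: "\<And>t. t \<in> {0..\<tau>} \<Longrightarrow> (A has_real_derivative moment 1 (lin (A t) (B t))) (at t within {0..\<tau>})"
    and B: "\<And>t. t \<in> {0..\<tau>} \<Longrightarrow> (B has_real_derivative moment 0 (lin (A t) (B t)) / K) (at t within {0..\<tau>})"
    and A': "\<And>t. t \<in> {0..\<tau>} \<Longrightarrow> (A' has_real_derivative moment 1 (lin (A' t) (B' t))) (at t within {0..\<tau>})"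
    and B': "\<And>t. t \<in> {0..\<tau>} \<Longrightarrow> (B' has_real_derivative moment 0 (lin (A' t) (B' t)) / K) (at t within {0..\<tau>})"
    and init: "A 0 = A' 0" "B 0 = B' 0"
  shows "A \<tau> = A' \<tau>" "B \<tau> = B' \<tau>"
proof -
  have "continuous_on {0..\<tau>} (\<lambda>t. (\<bar>A t\<bar> + \<bar>B t\<bar>) + (\<bar>A' t\<bar> + \<bar>B' t\<bar>))"
    using DERIV_continuous_on[OF A] DERIV_continuous_on[OF B] DERIV_continuous_on[OF A'] DERIV_continuous_on[OF B']
    by (intro continuous_intros) auto
  then obtain t0 where "\<forall>t\<in>{0..\<tau>}. (\<bar>A t\<bar> + \<bar>B t\<bar>) + (\<bar>A' t\<bar> + \<bar>B' t\<bar>)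
      \<le> (\<bar>A t0\<bar> + \<bar>B t0\<bar>) + (\<bar>A' t0\<bar> + \<bar>B' t0\<bar>)"
    using continuous_attains_sup[of "{0..\<tau>}"] \<open>0 \<le> \<tau>\<close> by fastforce
  then obtain N where N: "\<And>t. t \<in> {0..\<tau>} \<Longrightarrow> (\<bar>A t\<bar> + \<bar>B t\<bar>) + (\<bar>A' t\<bar> + \<bar>B' t\<bar>) \<le> N"
    by blast
  have le: "lin a b y \<le> \<bar>a\<bar> + \<bar>b\<bar>" if "y \<in> {0..1}" for a b y :: real
  proof -
    have "\<bar>b * y\<bar> \<le> \<bar>b\<bar> * 1" unfolding abs_mult by (intro mult_left_mono) (use that in auto)
    then show ?thesis by linarith
  qed
  have field: "trunc_field K N (A t, B t) = (moment 1 (lin (A t) (B t)), moment 0 (lin (A t) (B t)) / K)"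
    "trunc_field K N (A' t, B' t) = (moment 1 (lin (A' t) (B' t)), moment 0 (lin (A' t) (B' t)) / K)"
    if "t \<in> {0..\<tau>}" for t
    using N[OF that] by (intro trunc_field_eq order_trans[OF le]; simp)+
  have "(A \<tau>, B \<tau>) = (A' \<tau>, B' \<tau>)"
  proof (rule gronwall_unique[where x="\<lambda>t. (A t, B t)" and y="\<lambda>t. (A' t, B' t)"])
    fix t assume t: "t \<in> {0..\<tau>}"
    show "((\<lambda>t. (A t, B t)) has_vector_derivative trunc_field K N (A t, B t)) (at t within {0..\<tau>})"
      unfolding field(1)[OF t] using A[OF t] B[OF t]
      by (intro has_vector_derivative_Pair) (simp_all add: has_real_derivative_iff_has_vector_derivative)
    show "((\<lambda>t. (A' t, B' t)) has_vector_derivative trunc_field K N (A' t, B' t)) (at t within {0..\<tau>})"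
      unfolding field(2)[OF t] using A'[OF t] B'[OF t]
      by (intro has_vector_derivative_Pair) (simp_all add: has_real_derivative_iff_has_vector_derivative)
  qed (use assms trunc_field_lipschitz in auto)
  then show "A \<tau> = A' \<tau>" "B \<tau> = B' \<tau>" by auto
qed

text \<open>
  Adding \<open>m\<^sub>1 \<le> m\<^sub>0\<close> and twice \<open>3 B m\<^sub>1 \<le> m\<^sub>0\<close> gives \<open>(1 + 6 B) m\<^sub>1 \<le> 3 m\<^sub>0\<close>, a form without
  singularity at \<open>B = 0\<close>; hence \<open>A \<le> (K/2) ln (1 + 6 B) \<le> (2/3) ln (1 + 6 B)\<close>.  In the same way
  \<open>(1 + 6 B) m\<^sub>0 \<le> 3 e\<^sup>3\<^sup>A \<le> 3 (1 + 6 B)\<^sup>2\<close>, so \<open>1 + 6 B\<close> grows at most like \<open>e\<^bsup>18 t\<^esup>\<close>.  The restriction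
  \<open>K \<le> 4/3\<close> is what makes the last power a square, and growth of \<open>B\<close> at most exponential.
\<close>
lemma a_priori_bound:
  fixes A B :: "real \<Rightarrow> real"
  assumes K: "1 \<le> K" "K \<le> 4 / 3" and "0 \<le> \<tau>" and init: "A 0 = 0" "B 0 = 0"
    and contA: "continuous_on {0..\<tau>} A" and contB: "continuous_on {0..\<tau>} B"
    and dA: "\<And>t. 0 < t \<Longrightarrow> t < \<tau> \<Longrightarrow> (A has_real_derivative moment 1 (lin (A t) (B t))) (at t)"
    and dB: "\<And>t. 0 < t \<Longrightarrow> t < \<tau> \<Longrightarrow> (B has_real_derivative moment 0 (lin (A t) (B t)) / K) (at t)"
  shows "A \<tau> \<le> 18 * \<tau>"
proof -
  have B_nonneg: "0 \<le> B t" if "t \<in> {0..\<tau>}" for t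
  proof -
    have "B 0 \<le> B t"
    proof (rule DERIV_nonneg_imp_increasing_open[of 0 t B])
      show "continuous_on {0..t} B" by (rule continuous_on_subset[OF contB]) (use that in auto)
      fix s assume "0 < s" "s < t"
      then show "\<exists>y. (B has_real_derivative y) (at s) \<and> 0 \<le> y"
        using dB[of s] that K by (intro exI conjI) (auto simp: moment_nonneg)
    qed (use that in auto)
    then show ?thesis by (simp add: init)
  qed
  define l where "l t = ln (1 + 6 * B t)" for t
  have cont_l: "continuous_on {0..\<tau>} l"
    unfolding l_def using B_nonneg by (intro continuous_intros contB) (smt (verit))
  have dl: "(l has_real_derivative 6 * (moment 0 (lin (A t) (B t)) / K) / (1 + 6 * B t)) (at t)"
    if "0 < t" "t < \<tau>" for t
    unfolding l_def using dB[OF that] B_nonneg[of t] that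
    by (auto intro!: derivative_eq_intros simp: mult.commute)
  have A_le: "A t \<le> 2 / 3 * l t" if t: "t \<in> {0..\<tau>}" for t
  proof -
    have "2 / 3 * l 0 - A 0 \<le> 2 / 3 * l t - A t"
    proof (rule DERIV_nonneg_imp_increasing_open[of 0 t "\<lambda>t. 2 / 3 * l t - A t"])
      show "continuous_on {0..t} (\<lambda>t. 2 / 3 * l t - A t)"
        using t by (intro continuous_intros continuous_on_subset[OF cont_l] continuous_on_subset[OF contA]) auto
      fix s assume s: "0 < s" "s < t"
      define m0 m1 b where "m0 = moment 0 (lin (A s) (B s))" and "m1 = moment 1 (lin (A s) (B s))" and "b = B s"
      have b: "0 \<le> b" using B_nonneg[of s] s t by (simp add: b_def)
      have "m1 \<le> m0" unfolding m0_def m1_def by (intro moment_antimono continuous_on_lin) simp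
      moreover have "3 * b * m1 \<le> m0" unfolding m0_def m1_def b_def
        using moment1_upper b b_def by simp
      ultimately have "(1 + 6 * b) * m1 \<le> 3 * m0" by (simp add: algebra_simps)
      also have "\<dots> \<le> 4 * m0 / K"
        using K moment_nonneg[of 0 "lin (A s) (B s)"] mult_right_mono[of K "4/3" m0]
        by (simp add: field_simps m0_def)
      finally have "m1 * (1 + 6 * b) \<le> 4 * m0 / K" by (simp only: mult.commute)
      then have "m1 \<le> 4 * m0 / K / (1 + 6 * b)"
        using b by (subst pos_le_divide_eq) auto
      then have "0 \<le> 2 / 3 * (6 * (m0 / K) / (1 + 6 * b)) - m1" by simp
      moreover have "((\<lambda>t. 2 / 3 * l t - A t) has_real_derivative 2 / 3 * (6 * (m0 / K) / (1 + 6 * b)) - m1) (at s)"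
        unfolding m0_def m1_def b_def using s t by (intro DERIV_diff DERIV_cmult dl dA) auto
      ultimately show "\<exists>y. ((\<lambda>t. 2 / 3 * l t - A t) has_real_derivative y) (at s) \<and> 0 \<le> y" by blast
    qed (use t in auto)
    then show ?thesis by (simp add: l_def init)
  qed
  have "18 * 0 - l 0 \<le> 18 * \<tau> - l \<tau>"
  proof (rule DERIV_nonneg_imp_increasing_open[of 0 \<tau> "\<lambda>t. 18 * t - l t", OF \<open>0 \<le> \<tau>\<close>])
    show "continuous_on {0..\<tau>} (\<lambda>t. 18 * t - l t)" by (intro continuous_intros cont_l)
    fix s assume s: "0 < s" "s < \<tau>"
    define m0 a b where "m0 = moment 0 (lin (A s) (B s))" and "a = A s" and "b = B s"
    have b: "0 \<le> b" using B_nonneg[of s] s by (simp add: b_def)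
    have "m0 \<le> exp (3 * a)" unfolding m0_def
      by (intro moment_le_exp continuous_on_lin) (use b in \<open>auto simp: a_def b_def\<close>)
    moreover have "3 * b * m0 \<le> exp (3 * a)"
      using moment0_upper[of b a] b unfolding m0_def a_def b_def by (cases "B s = 0") auto
    ultimately have "(1 + 6 * b) * m0 \<le> 3 * exp (3 * a)" by (simp add: algebra_simps)
    also have "exp (3 * a) \<le> exp (2 * l s)" using A_le[of s] s by (simp add: a_def)
    also have "exp (2 * l s) = (1 + 6 * b)\<^sup>2" using b by (simp add: l_def b_def exp_double)
    finally have "(1 + 6 * b) * m0 \<le> (1 + 6 * b) * (3 * (1 + 6 * b))"
      by (simp only: power2_eq_square mult.left_commute)
    then have "m0 \<le> 3 * (1 + 6 * b)" using b by (subst (asm) mult_le_cancel_left_pos) auto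
    moreover have "m0 / K \<le> m0" using K moment_nonneg[of 0 "lin (A s) (B s)"]
      by (simp add: divide_le_eq mult_le_cancel_left1 m0_def)
    ultimately have "6 * (m0 / K) / (1 + 6 * b) \<le> 18" using b by (subst pos_divide_le_eq) auto
    then have "0 \<le> 18 * 1 - 6 * (m0 / K) / (1 + 6 * b)" by simp
    moreover have "((\<lambda>t. 18 * t - l t) has_real_derivative 18 * 1 - 6 * (m0 / K) / (1 + 6 * b)) (at s)"
      unfolding m0_def b_def using s by (intro DERIV_diff DERIV_cmult DERIV_ident dl) auto
    ultimately show "\<exists>y. ((\<lambda>t. 18 * t - l t) has_real_derivative y) (at s) \<and> 0 \<le> y" by blast
  qed
  then have "l \<tau> \<le> 18 * \<tau>" by (simp add: l_def init)
  then show ?thesis using A_le[of \<tau>] \<open>0 \<le> \<tau>\<close> by simp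
qed

lemma DERIV_at_of_within_atLeast:
  fixes f :: "real \<Rightarrow> real"
  assumes "(f has_real_derivative d) (at t within {0..})" "0 < t"
  shows "(f has_real_derivative d) (at t)"
  using assms at_within_interior[of t "{0..}"] by simp

text \<open>
  Solve with the exponent cut off at \<open>N(t) = 1 + 18 t\<close>.  Up to the first time at which \<open>A\<close> reaches \<open>N\<close> the
  cut-off is inactive, because \<open>B \<ge> 0\<close>; but at that time the a priori bound gives \<open>A < N\<close>.
\<close>
lemma global_profile:
  assumes K: "1 \<le> K" "K \<le> 4 / 3"
  obtains A B :: "real \<Rightarrow> real" where "A 0 = 0" "B 0 = 0"
    and "\<And>t. 0 \<le> t \<Longrightarrow> (A has_real_derivative moment 1 (lin (A t) (B t))) (at t within {0..})"
    and "\<And>t. 0 \<le> t \<Longrightarrow> (B has_real_derivative moment 0 (lin (A t) (B t)) / K) (at t within {0..})"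
proof -
  define N where "N t = 1 + 18 * t" for t :: real
  obtain x where x0: "x 0 = (0, 0)"
    and dx: "\<And>t. 0 \<le> t \<Longrightarrow> (x has_vector_derivative trunc_field K (N t) (x t)) (at t within {0..})"
  proof (rule picard_global[of "\<lambda>t. trunc_field K (N t)" "\<lambda>t. 12 * exp (3 * N t)"
        "\<lambda>t. 12 / 54 * (exp (3 * N t) - exp 3)" "(0, 0)"])
    have "continuous_on U (\<lambda>p::real \<times> real \<times> real. moment n (\<lambda>y. min (lin (fst (snd p)) (snd (snd p)) y) (N (fst p))))" for U n
      by (rule continuous_on_moment) (auto simp: N_def split_beta intro!: continuous_intros)
    then show "continuous_on ({0..} \<times> UNIV) (\<lambda>(t, p). trunc_field K (N t) p)"
      unfolding trunc_field_def split_beta using K by (intro continuous_intros) auto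
    fix t :: real and p q assume "0 \<le> t"
    show "norm (trunc_field K (N t) p - trunc_field K (N t) q) \<le> 12 * exp (3 * N t) * norm (p - q)"
      by (rule trunc_field_lipschitz[OF K(1)])
    show "norm (trunc_field K (N t) 0) \<le> 12 * exp (3 * N t)"
      using trunc_field_bound[OF K(1), of "N t" 0] by (rule order_trans) simp
    show "((\<lambda>t. 12 / 54 * (exp (3 * N t) - exp 3)) has_real_derivative 12 * exp (3 * N t)) (at t)"
      unfolding N_def by (auto intro!: derivative_eq_intros)
  qed (auto simp: N_def)
  define A B where "A t = fst (x t)" and "B t = snd (x t)" for t
  have x_eq: "x t = (A t, B t)" for t by (simp add: A_def B_def)
  have init: "A 0 = 0" "B 0 = 0" using x0 by (simp_all add: A_def B_def)
  have dA: "(A has_real_derivative fst (trunc_field K (N t) (A t, B t))) (at t within {0..})"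
    and dB: "(B has_real_derivative snd (trunc_field K (N t) (A t, B t))) (at t within {0..})" if "0 \<le> t" for t
    using bounded_linear.has_vector_derivative[OF bounded_linear_fst dx[OF that]]
      bounded_linear.has_vector_derivative[OF bounded_linear_snd dx[OF that]]
    unfolding A_def B_def has_real_derivative_iff_has_vector_derivative by simp_all
  have contA: "continuous_on {0..} A" and contB: "continuous_on {0..} B"
    by (rule DERIV_continuous_on, use dA in force) (rule DERIV_continuous_on, use dB in force)
  have B_nonneg: "0 \<le> B t" if "0 \<le> t" for t
  proof -
    have "B 0 \<le> B t"
    proof (rule DERIV_nonneg_imp_increasing_open[of 0 t B, OF that])
      show "continuous_on {0..t} B" by (rule continuous_on_subset[OF contB]) auto
      fix s :: real assume "0 < s"
      then show "\<exists>y. (B has_real_derivative y) (at s) \<and> 0 \<le> y"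
        using DERIV_at_of_within_atLeast[OF dB[of s]] K
        by (intro exI conjI) (auto simp: trunc_field_def moment_nonneg)
    qed
    then show ?thesis by (simp add: init)
  qed
  have field: "trunc_field K (N t) (A t, B t) = (moment 1 (lin (A t) (B t)), moment 0 (lin (A t) (B t)) / K)"
    if "0 \<le> t" "A t \<le> N t" for t
  proof (rule trunc_field_eq)
    fix y :: real assume "y \<in> {0..1}"
    then have "0 \<le> B t * y" using B_nonneg[OF that(1)] by simp
    then show "lin (A t) (B t) y \<le> N t" using that by linarith
  qed
  have A_less: "A t < N t" if "0 \<le> t" for t
  proof (rule ccontr)
    assume "\<not> A t < N t"
    \<comment> \<open>The infimum of \<open>S\<close> is the first time at which the cut-off level is reached.\<close>
    define S where "S = {0..} \<inter> (\<lambda>t. A t - N t) -` {0..}"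
    have "t \<in> S" using \<open>\<not> A t < N t\<close> that by (simp add: S_def)
    have "closed S" unfolding S_def N_def
      by (intro continuous_closed_preimage continuous_intros contA closed_atLeast)
    moreover have "bdd_below S" by (rule bdd_belowI[of _ 0]) (simp add: S_def)
    ultimately have S: "Inf S \<in> S" using \<open>t \<in> S\<close> closed_contains_Inf by blast
    have below: "A s \<le> N s" if "0 < s" "s < Inf S" for s
      using cInf_lower[OF _ \<open>bdd_below S\<close>, of s] that by (force simp: S_def)
    have "A (Inf S) \<le> 18 * Inf S"
    proof (rule a_priori_bound[of K "Inf S" A B])
      show "0 \<le> Inf S" using S by (simp add: S_def)
      show "continuous_on {0..Inf S} A" "continuous_on {0..Inf S} B"
        by (rule continuous_on_subset[OF contA] continuous_on_subset[OF contB]; force)+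
      fix s :: real assume s: "0 < s" "s < Inf S"
      show "(A has_real_derivative moment 1 (lin (A s) (B s))) (at s)"
        using DERIV_at_of_within_atLeast[OF dA[of s]] s field[of s] below[of s] by simp
      show "(B has_real_derivative moment 0 (lin (A s) (B s)) / K) (at s)"
        using DERIV_at_of_within_atLeast[OF dB[of s]] s field[of s] below[of s] by simp
    qed (use K init in auto)
    then show False using S by (simp add: S_def N_def)
  qed
  show thesis
  proof
    fix t :: real assume t: "0 \<le> t"
    show "(A has_real_derivative moment 1 (lin (A t) (B t))) (at t within {0..})"
      using dA[OF t] field[OF t less_imp_le[OF A_less[OF t]]] by simp
    show "(B has_real_derivative moment 0 (lin (A t) (B t)) / K) (at t within {0..})"
      using dB[OF t] field[OF t less_imp_le[OF A_less[OF t]]] by simp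
  qed (use init in auto)
qed

section \<open>Asymptotics\<close>

lemma comparable_from_1_powr:
  assumes "comparable_from_1 X Y" "0 \<le> p"
  shows "comparable_from_1 (\<lambda>t. X t powr p) (\<lambda>t. Y t powr p)"
proof -
  obtain C where C: "1 \<le> C" and pos: "\<And>t. 1 \<le> t \<Longrightarrow> 0 < X t \<and> 0 < Y t"
    and bd: "\<And>t. 1 \<le> t \<Longrightarrow> 1 / C * Y t \<le> X t \<and> X t \<le> C * Y t"
    using assms(1) unfolding comparable_from_1_def by blast
  show ?thesis
    unfolding comparable_from_1_def
  proof (intro conjI allI impI exI[of _ "C powr p"])
    fix t :: real assume t: "1 \<le> t"
    show "0 < X t powr p" "0 < Y t powr p" using pos[OF t] by auto
    have "1 / C powr p * Y t powr p = (1 / C * Y t) powr p"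
      using C pos[OF t] by (simp add: powr_divide)
    also have "\<dots> \<le> X t powr p"
      using C pos[OF t] bd[OF t] assms(2) by (intro powr_mono2) auto
    finally show "1 / C powr p * Y t powr p \<le> X t powr p" .
    have "X t powr p \<le> (C * Y t) powr p"
      using C pos[OF t] bd[OF t] assms(2) by (intro powr_mono2) auto
    then show "X t powr p \<le> C powr p * Y t powr p"
      using C pos[OF t] by (simp add: powr_mult)
  qed (use C assms(2) in \<open>auto simp: ge_one_powr_ge_zero\<close>)
qed

lemma comparable_from_1_linear:
  fixes V V' :: "real \<Rightarrow> real"
  assumes deriv: "\<And>t. 1 \<le> t \<Longrightarrow> (V has_real_derivative V' t) (at t)"
    and bounds: "\<And>t. 1 \<le> t \<Longrightarrow> lo \<le> V' t \<and> V' t \<le> hi" and "0 < lo" "0 < V 1"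
  shows "comparable_from_1 V (\<lambda>t. t)"
proof -
  define m where "m = min lo (V 1)"
  define M where "M = max hi (V 1)"
  have m: "0 < m" "m \<le> lo" "m \<le> V 1" and M: "hi \<le> M" "V 1 \<le> M"
    using assms by (auto simp: m_def M_def)
  have lower: "m * t \<le> V t" if "1 \<le> t" for t
  proof -
    have "V 1 - m * 1 \<le> V t - m * t"
    proof (rule DERIV_nonneg_imp_nondecreasing[OF that, of "\<lambda>t. V t - m * t"])
      fix s :: real assume s: "1 \<le> s"
      have "((\<lambda>t. V t - m * t) has_real_derivative V' s - m * 1) (at s)"
        by (intro DERIV_diff DERIV_cmult DERIV_ident deriv s)
      moreover have "0 \<le> V' s - m * 1" using bounds[OF s] m by linarith
      ultimately show "\<exists>y. ((\<lambda>t. V t - m * t) has_real_derivative y) (at s) \<and> 0 \<le> y" by blast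
    qed
    then show ?thesis using m by linarith
  qed
  have upper: "V t \<le> M * t" if "1 \<le> t" for t
  proof -
    have "M * 1 - V 1 \<le> M * t - V t"
    proof (rule DERIV_nonneg_imp_nondecreasing[OF that, of "\<lambda>t. M * t - V t"])
      fix s :: real assume s: "1 \<le> s"
      have "((\<lambda>t. M * t - V t) has_real_derivative M * 1 - V' s) (at s)"
        by (intro DERIV_diff DERIV_cmult DERIV_ident deriv s)
      moreover have "0 \<le> M * 1 - V' s" using bounds[OF s] M by linarith
      ultimately show "\<exists>y. ((\<lambda>t. M * t - V t) has_real_derivative y) (at s) \<and> 0 \<le> y" by blast
    qed
    then show ?thesis using M by linarith
  qed
  define C where "C = max 1 (max (1 / m) M)"
  have C: "1 \<le> C" "1 / m \<le> C" "M \<le> C" by (auto simp: C_def)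
  have "1 / C \<le> m" using C(1,2) m by (simp add: field_simps)
  have "\<forall>t\<ge>1. 0 < V t \<and> 0 < t" using lower m by (smt (verit) mult_pos_pos)
  moreover have "1 / C * t \<le> V t" if "1 \<le> t" for t
    using mult_right_mono[OF \<open>1 / C \<le> m\<close>, of t] lower[OF that] that by linarith
  moreover have "V t \<le> C * t" if "1 \<le> t" for t
    using mult_right_mono[OF C(3), of t] upper[OF that] that by linarith
  ultimately show ?thesis unfolding comparable_from_1_def using C(1) by blast
qed

text \<open>
  The quantity \<open>D = A - (K/3) ln B\<close> is monotone by the virial inequality and, by \<open>moment1_lower\<close>, stays within
  a bounded distance of its value at time \<open>1\<close>.  Boundedness of \<open>D\<close> is the first claim.  In terms of \<open>D\<close>, the
  derivative of \<open>B\<^bsup>2-K\<^esup>\<close> is \<open>e\<^bsup>3D\<^esup>\<close> up to constant factors, which is the second claim.  The assumption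
  \<open>K \<le> 3/2\<close> serves the crude form \<open>e\<^sup>2\<^sup>A \<le> \<kappa> B\<close> of the upper bound, which suffices for all error terms.
\<close>
lemma profile_asymptotics:
  fixes A B :: "real \<Rightarrow> real"
  assumes K: "1 \<le> K" "K \<le> 3 / 2" and init: "B 0 = 0"
    and dA0: "\<And>t. 0 \<le> t \<Longrightarrow> (A has_real_derivative moment 1 (lin (A t) (B t))) (at t within {0..})"
    and dB0: "\<And>t. 0 \<le> t \<Longrightarrow> (B has_real_derivative moment 0 (lin (A t) (B t)) / K) (at t within {0..})"
  shows "comparable_from_1 (\<lambda>t. exp (A t)) (\<lambda>t. B t powr (K / 3))"
    and "comparable_from_1 B (\<lambda>t. t powr (1 / (2 - K)))"
proof -
  define m0 m1 where "m0 t = moment 0 (lin (A t) (B t))" and "m1 t = moment 1 (lin (A t) (B t))" for t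
  have dA: "(A has_real_derivative m1 t) (at t)" and dB: "(B has_real_derivative m0 t / K) (at t)" if "0 < t" for t
    unfolding m0_def m1_def using DERIV_at_of_within_atLeast[OF dA0] DERIV_at_of_within_atLeast[OF dB0] that by simp_all
  have m0_pos: "0 < m0 t" for t
    unfolding m0_def by (intro moment0_pos continuous_on_lin)
  define \<beta> where "\<beta> = B 1"
  have "B 0 < B 1"
  proof (rule DERIV_pos_imp_increasing_open[of 0 1 B])
    fix s :: real assume "0 < s"
    then show "\<exists>y. (B has_real_derivative y) (at s) \<and> 0 < y"
      using dB[of s] m0_pos[of s] K by (intro exI[of _ "m0 s / K"]) auto
  next
    show "continuous_on {0..1} B"
      by (rule continuous_on_subset[of "{0..}"], rule DERIV_continuous_on, use dB0 in force) auto
  qed simp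
  then have \<beta>: "0 < \<beta>" by (simp add: \<beta>_def init)
  have B_ge: "\<beta> \<le> B t" if "1 \<le> t" for t
    unfolding \<beta>_def
  proof (rule DERIV_nonneg_imp_nondecreasing[OF that, of B])
    fix s :: real assume "1 \<le> s"
    then show "\<exists>y. (B has_real_derivative y) (at s) \<and> 0 \<le> y"
      using dB[of s] m0_pos[of s] K by (intro exI conjI) auto
  qed
  have B_pos: "0 < B t" if "1 \<le> t" for t using B_ge[OF that] \<beta> by linarith
  have dlnB: "((\<lambda>t. ln (B t)) has_real_derivative m0 t / K / B t) (at t)" if "1 \<le> t" for t
    using dB[of t] B_pos[OF that] that by (auto intro!: derivative_eq_intros)
  have m1_le: "m1 t \<le> m0 t / (3 * B t)" if "1 \<le> t" for t
    using moment1_upper[of "B t" "A t"] B_pos[OF that]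
    by (simp add: m0_def m1_def pos_le_divide_eq mult.commute mult.left_commute)

  define D where "D t = A t - K / 3 * ln (B t)" for t
  have D_le: "D t \<le> D 1" if "1 \<le> t" for t
  proof (rule DERIV_nonpos_imp_nonincreasing[OF that, of D])
    fix s :: real assume s: "1 \<le> s"
    have "(D has_real_derivative m1 s - K / 3 * (m0 s / K / B s)) (at s)"
      unfolding D_def using s by (intro DERIV_diff DERIV_cmult dA dlnB) auto
    moreover have "m1 s - K / 3 * (m0 s / K / B s) \<le> 0" using m1_le[OF s] K by simp
    ultimately show "\<exists>y. (D has_real_derivative y) (at s) \<and> y \<le> 0" by blast
  qed

  define \<kappa> where "\<kappa> = exp (2 * A 1 - ln \<beta>)"
  have \<kappa>: "0 < \<kappa>" by (simp add: \<kappa>_def)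
  have exp2A: "exp (2 * A t) \<le> \<kappa> * B t" if "1 \<le> t" for t
  proof -
    have "2 * A t - ln (B t) \<le> 2 * A 1 - ln (B 1)"
    proof (rule DERIV_nonpos_imp_nonincreasing[OF that, of "\<lambda>t. 2 * A t - ln (B t)"])
      fix s :: real assume s: "1 \<le> s"
      have "((\<lambda>t. 2 * A t - ln (B t)) has_real_derivative 2 * m1 s - m0 s / K / B s) (at s)"
        using s by (intro DERIV_diff DERIV_cmult dA dlnB) auto
      moreover have "2 * m1 s \<le> m0 s / K / B s"
      proof -
        have "2 * m1 s \<le> 2 / 3 * (m0 s / B s)" using m1_le[OF s] by simp
        also have "\<dots> \<le> 1 / K * (m0 s / B s)"
          using K m0_pos[of s] B_pos[OF s] by (intro mult_right_mono) (auto simp: field_simps)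
        finally show ?thesis by simp
      qed
      ultimately show "\<exists>y. ((\<lambda>t. 2 * A t - ln (B t)) has_real_derivative y) (at s) \<and> y \<le> 0" by force
    qed
    then have "2 * A t \<le> (2 * A 1 - ln \<beta>) + ln (B t)" by (simp add: \<beta>_def)
    then have "exp (2 * A t) \<le> exp ((2 * A 1 - ln \<beta>) + ln (B t))" by simp
    then show ?thesis using B_pos[OF that] by (simp add: exp_add \<kappa>_def)
  qed

  \<comment> \<open>By \<open>exp2A\<close>, the quotient \<open>(e\<^sup>A / B)\<^sup>2\<close> in \<open>moment0_lower\<close> is at most \<open>\<kappa> / \<beta>\<close>.\<close>
  define c where "c = (1 - exp (- (3 * \<beta>))) / 3 / (1 + \<kappa> / \<beta>)\<^sup>2"
  have c: "0 < c"
    unfolding c_def using \<beta> \<kappa> by (intro divide_pos_pos zero_less_power add_pos_pos) auto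
  have m0_ge: "c * exp (3 * A t) / B t \<le> m0 t" if "1 \<le> t" for t
  proof -
    have b: "0 < B t" "\<beta> \<le> B t" using B_pos B_ge that by auto
    have "(exp (A t) / B t)\<^sup>2 = exp (2 * A t) / B t / B t"
      by (simp add: exp_double power_divide power2_eq_square)
    also have "\<dots> \<le> \<kappa> / B t"
      using exp2A[OF that] b by (intro divide_right_mono) (auto simp: divide_le_eq)
    also have "\<dots> \<le> \<kappa> / \<beta>" using b \<kappa> \<beta> by (intro divide_left_mono) auto
    finally have q: "(1 + (exp (A t) / B t)\<^sup>2)\<^sup>2 \<le> (1 + \<kappa> / \<beta>)\<^sup>2" by (intro power_mono) auto
    have "c * exp (3 * A t) / B t = exp (3 * A t) * (1 - exp (- (3 * \<beta>))) / (3 * B t) / (1 + \<kappa> / \<beta>)\<^sup>2"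
      by (simp add: c_def ac_simps)
    also have "\<dots> \<le> exp (3 * A t) * (1 - exp (- (3 * B t))) / (3 * B t) / (1 + (exp (A t) / B t)\<^sup>2)\<^sup>2"
      using b \<beta> by (intro frac_le[OF _ _ _ q] divide_right_mono mult_left_mono zero_less_power one_plus_square_pos
        divide_nonneg_pos mult_nonneg_nonneg) auto
    also have "\<dots> \<le> m0 t" unfolding m0_def by (rule moment0_lower[OF b(1)])
    finally show ?thesis .
  qed

  \<comment> \<open>The defect \<open>m\<^sub>0 - 3 B m\<^sub>1\<close> is at most \<open>e m\<^sub>0 / B\<close>; divided by \<open>3 B\<close> it becomes a multiple of
    \<open>m\<^sub>0 / B\<^sup>2\<close>, the derivative of a multiple of \<open>- 1 / B\<close>.\<close>
  define e where "e = (1 + \<kappa>) / c"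
  have m1_ge: "m0 t / (3 * B t) - e * m0 t / (3 * (B t)\<^sup>2) \<le> m1 t" if "1 \<le> t" for t
  proof -
    define b where "b = B t"
    have b: "0 < b" using B_pos that by (simp add: b_def)
    have "b \<le> exp b" using exp_ge_add_one_self[of b] by linarith
    then have "b\<^sup>2 \<le> (exp b)\<^sup>2" by (rule power_mono) (rule less_imp_le[OF b])
    also have "\<dots> \<le> exp (3 * b)" using b unfolding exp_double[symmetric] by simp
    finally have "exp (- (3 * b)) \<le> 1 / b\<^sup>2" using b by (simp add: exp_minus field_simps)
    moreover have "exp (2 * A t) / (2 * b ^ 3) \<le> \<kappa> * b / (b ^ 3)"
      using exp2A[OF that] b \<kappa> by (intro frac_le) (auto simp: b_def)
    moreover have "\<kappa> * b / b ^ 3 = \<kappa> / b\<^sup>2" using b by (simp add: power2_eq_square power3_eq_cube)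
    ultimately have "exp (- (3 * b)) + exp (2 * A t) / (2 * b ^ 3) \<le> (1 + \<kappa>) / b\<^sup>2"
      by (simp add: add_divide_distrib)
    then have "exp (3 * A t) * (exp (- (3 * b)) + exp (2 * A t) / (2 * b ^ 3)) \<le> exp (3 * A t) * ((1 + \<kappa>) / b\<^sup>2)"
      by (intro mult_left_mono) auto
    also have "\<dots> = e * (c * exp (3 * A t) / b) / b"
      using c by (simp add: e_def power2_eq_square)
    also have "\<dots> \<le> e * m0 t / b"
      using m0_ge[OF that] b c \<kappa> by (intro divide_right_mono mult_left_mono) (auto simp: b_def e_def)
    finally have "m0 t - 3 * b * m1 t \<le> e * m0 t / b"
      using moment1_lower[of b "A t"] b by (simp add: m0_def m1_def b_def)
    then have "(m0 t - 3 * b * m1 t) / (3 * b) \<le> e * m0 t / b / (3 * b)"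
      using b by (intro divide_right_mono) auto
    then show ?thesis using b by (simp add: b_def diff_divide_distrib power2_eq_square)
  qed

  define \<gamma> where "\<gamma> = D 1 - e * K / 3 / \<beta>"
  have e: "0 < e" using c \<kappa> by (simp add: e_def)
  have D_ge: "\<gamma> \<le> D t" if "1 \<le> t" for t
  proof -
    have "D 1 - e * K / 3 * inverse (B 1) \<le> D t - e * K / 3 * inverse (B t)"
    proof (rule DERIV_nonneg_imp_nondecreasing[OF that, of "\<lambda>t. D t - e * K / 3 * inverse (B t)"])
      fix s :: real assume s: "1 \<le> s"
      define d where "d = m1 s - K / 3 * (m0 s / K / B s) - e * K / 3 * (- (inverse (B s) * (m0 s / K) * inverse (B s)))"
      have "((\<lambda>t. D t - e * K / 3 * inverse (B t)) has_real_derivative d) (at s)"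
        unfolding D_def d_def using s B_pos[OF s]
        by (intro DERIV_diff DERIV_cmult dA dB dlnB DERIV_inverse') auto
      moreover have "d = m1 s - (m0 s / (3 * B s) - e * m0 s / (3 * (B s)\<^sup>2))"
        using K B_pos[OF s] by (simp add: d_def power2_eq_square field_simps)
      then have "0 \<le> d" using m1_ge[OF s] by simp
      ultimately show "\<exists>y. ((\<lambda>t. D t - e * K / 3 * inverse (B t)) has_real_derivative y) (at s) \<and> 0 \<le> y"
        by blast
    qed
    moreover have "0 \<le> e * K / 3 * inverse (B t)" using e K B_pos[OF that] by simp
    ultimately show ?thesis unfolding \<gamma>_def \<beta>_def divide_inverse[of _ "B 1"] by linarith
  qed
  have expA: "exp (A t) = B t powr (K / 3) * exp (D t)" if "1 \<le> t" for t
    using B_pos[OF that] by (simp add: D_def powr_def flip: exp_add)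

  show "comparable_from_1 (\<lambda>t. exp (A t)) (\<lambda>t. B t powr (K / 3))"
    unfolding comparable_from_1_def
  proof (intro conjI allI impI exI[of _ "exp (\<bar>D 1\<bar> + \<bar>\<gamma>\<bar>)"])
    fix t :: real assume t: "1 \<le> t"
    show "0 < B t powr (K / 3)" using B_pos[OF t] by simp
    have "1 / exp (\<bar>D 1\<bar> + \<bar>\<gamma>\<bar>) \<le> exp (D t)"
      using D_ge[OF t] by (simp add: exp_minus[symmetric] flip: inverse_eq_divide)
    then show "1 / exp (\<bar>D 1\<bar> + \<bar>\<gamma>\<bar>) * B t powr (K / 3) \<le> exp (A t)"
      unfolding expA[OF t] by (subst mult.commute) (intro mult_left_mono, auto)
    have "exp (D t) \<le> exp (\<bar>D 1\<bar> + \<bar>\<gamma>\<bar>)" using D_le[OF t] by simp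
    then show "exp (A t) \<le> exp (\<bar>D 1\<bar> + \<bar>\<gamma>\<bar>) * B t powr (K / 3)"
      unfolding expA[OF t] by (subst (2) mult.commute) (intro mult_left_mono, auto)
  qed auto

  define V where "V t = B t powr (2 - K)" for t
  define V' where "V' t = (2 - K) * B t powr (1 - K) * (m0 t / K)" for t
  have "comparable_from_1 V (\<lambda>t. t)"
  proof (rule comparable_from_1_linear[of V V' "(2 - K) / K * (c * exp (3 * \<gamma>))"
        "(2 - K) / K * (1 / 3 * exp (3 * D 1))"])
    show "0 < V 1" using B_pos[of 1] by (simp add: V_def)
    show "0 < (2 - K) / K * (c * exp (3 * \<gamma>))" using K c by simp
  next
    fix t :: real assume t: "1 \<le> t"
    show "(V has_real_derivative V' t) (at t)"
      unfolding V_def V'_def using dB[of t] B_pos[OF t] t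
      by (auto intro!: derivative_eq_intros simp: powr_diff power2_eq_square field_simps)
    have "exp (3 * A t) = exp (A t) ^ 3" by (metis exp_of_nat_mult of_nat_numeral)
    also have "\<dots> = B t powr K * exp (3 * D t)"
      using B_pos[OF t] unfolding expA[OF t] power_mult_distrib
      by (simp add: powr_power flip: exp_of_nat_mult)
    finally have "B t powr (1 - K) * (exp (3 * A t) / B t) = exp (3 * D t)"
      using B_pos[OF t] by (simp add: powr_diff)
    then have scale: "B t powr (1 - K) * (r * exp (3 * A t) / B t) = r * exp (3 * D t)" for r
      by (simp add: mult.left_commute flip: times_divide_eq_right)
    have pos: "0 \<le> (2 - K) / K" using K by simp
    have V'_eq: "V' t = (2 - K) / K * (B t powr (1 - K) * m0 t)" by (simp add: V'_def)
    have "c * exp (3 * \<gamma>) \<le> c * exp (3 * D t)" using D_ge[OF t] c by simp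
    also have "\<dots> \<le> B t powr (1 - K) * m0 t"
      unfolding scale[symmetric] by (intro mult_left_mono m0_ge t) auto
    finally have lo: "c * exp (3 * \<gamma>) \<le> B t powr (1 - K) * m0 t" .
    have "m0 t \<le> 1 / 3 * exp (3 * A t) / B t"
      using moment0_upper[OF B_pos[OF t], of "A t"] B_pos[OF t] by (simp add: m0_def field_simps)
    then have "B t powr (1 - K) * m0 t \<le> 1 / 3 * exp (3 * D t)"
      unfolding scale[symmetric] by (intro mult_left_mono) auto
    also have "\<dots> \<le> 1 / 3 * exp (3 * D 1)" using D_le[OF t] by simp
    finally have hi: "B t powr (1 - K) * m0 t \<le> 1 / 3 * exp (3 * D 1)" .
    show "(2 - K) / K * (c * exp (3 * \<gamma>)) \<le> V' t \<and> V' t \<le> (2 - K) / K * (1 / 3 * exp (3 * D 1))"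
      unfolding V'_eq by (intro conjI mult_left_mono lo hi pos)
  qed
  then have "comparable_from_1 (\<lambda>t. V t powr (1 / (2 - K))) (\<lambda>t. t powr (1 / (2 - K)))"
    by (rule comparable_from_1_powr) (use K in simp)
  moreover have "V t powr (1 / (2 - K)) = B t" if "1 \<le> t" for t
    using B_pos[OF that] K by (simp add: V_def powr_powr)
  ultimately show "comparable_from_1 B (\<lambda>t. t powr (1 / (2 - K)))"
    unfolding comparable_from_1_def by simp
qed

section \<open>Global solution and its growth\<close>

theorem theorem1p1:
  fixes K :: real
  assumes "1 \<le> K" and "K \<le> 1.3"
  shows "\<exists>G A B.
     ode_solution K {0..} G \<and>
     (\<forall>T H. 0 < T \<longrightarrow> ode_solution K {0..<T} H \<longrightarrow>
        (\<forall>x\<in>{0..1}. \<forall>t\<in>{0..<T}. H x t = G x t)) \<and>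
     (\<forall>x\<in>{0..1}. \<forall>t\<ge>0. G x t = A t - B t * x) \<and>
     A 0 = 0 \<and> B 0 = 0 \<and>
     comparable_from_1 (\<lambda>t. exp (A t)) (\<lambda>t. B t powr (K / 3)) \<and>
     comparable_from_1 B (\<lambda>t. t powr (1 / (2 - K)))"
proof -
  have K: "1 \<le> K" "K \<le> 4 / 3" "K \<le> 3 / 2" using assms by simp_all
  obtain A B :: "real \<Rightarrow> real" where init: "A 0 = 0" "B 0 = 0"
    and dA: "\<And>t. 0 \<le> t \<Longrightarrow> (A has_real_derivative moment 1 (lin (A t) (B t))) (at t within {0..})"
    and dB: "\<And>t. 0 \<le> t \<Longrightarrow> (B has_real_derivative moment 0 (lin (A t) (B t)) / K) (at t within {0..})"
    using global_profile[OF K(1,2)] by blast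
  define G where "G x t = A t - B t * x" for x t
  have "ode_solution K {0..} G"
    unfolding ode_solution_def
  proof (intro conjI ballI)
    fix x t :: real assume "x \<in> {0..1}" and t: "t \<in> {0..}"
    have int: "(ode_integrand K (\<lambda>y. G y t) x has_integral
        moment 1 (lin (A t) (B t)) - x / K * moment 0 (lin (A t) (B t))) {0..1}"
      by (rule has_integral_ode_integrand) (simp add: G_def)
    then show "ode_integrand K (\<lambda>y. G y t) x integrable_on {0..1}" by blast
    have "(G x has_real_derivative moment 1 (lin (A t) (B t)) - moment 0 (lin (A t) (B t)) / K * x) (at t within {0..})"
      unfolding G_def using t by (intro DERIV_diff DERIV_cmult_right dA dB) auto
    then show "(G x has_real_derivative integral {0..1} (ode_integrand K (\<lambda>y. G y t) x)) (at t within {0..})"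
      by (simp add: integral_unique[OF int] mult.commute)
  qed (simp add: G_def init)
  moreover have "H x t = G x t"
    if sol: "ode_solution K {0..<T} H" and x: "x \<in> {0..1}" and t: "t \<in> {0..<T}" for T H x t
  proof -
    have J: "convex {0..<T}" "0 \<in> {0..<T}" using t by auto
    define A' B' where "A' = H 0" and "B' = (\<lambda>t. H 0 t - H 1 t)"
    have sub: "{0..t} \<subseteq> {0..<T}" using t by auto
    have dA': "(A' has_real_derivative moment 1 (lin (A' s) (B' s))) (at s within {0..t})"
      and dB': "(B' has_real_derivative moment 0 (lin (A' s) (B' s)) / K) (at s within {0..t})"
      if "s \<in> {0..t}" for s
      using ode_solution_profile_derivs[OF sol J subsetD[OF sub that]] unfolding A'_def B'_def
      by (auto intro: has_field_derivative_subset[OF _ sub])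
    have dAt: "(A has_real_derivative moment 1 (lin (A s) (B s))) (at s within {0..t})"
      and dBt: "(B has_real_derivative moment 0 (lin (A s) (B s)) / K) (at s within {0..t})"
      if "s \<in> {0..t}" for s
    proof -
      have "0 \<le> s" using that by simp
      from dA[OF this] dB[OF this]
      show "(A has_real_derivative moment 1 (lin (A s) (B s))) (at s within {0..t})"
        "(B has_real_derivative moment 0 (lin (A s) (B s)) / K) (at s within {0..t})"
        by (auto intro: has_field_derivative_subset)
    qed
    have "0 \<le> t" "A' 0 = A 0" "B' 0 = B 0"
      using t sol by (simp_all add: A'_def B'_def init ode_solution_def)
    then have "A' t = A t" "B' t = B t"
      using profile_unique[OF K(1) _ dA' dB' dAt dBt] by simp_all
    then show ?thesis
      unfolding G_def A'_def B'_def using ode_solution_affine[OF sol J x t] by metis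
  qed
  moreover have "\<forall>x\<in>{0..1}. \<forall>t\<ge>0. G x t = A t - B t * x" by (simp add: G_def)
  ultimately show ?thesis
    using init profile_asymptotics[OF K(1,3) init(2) dA dB] by blast
qed

end
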